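(* The underlying $\mathbb{N}$-graded coalgebras of the $\mathbb{N}$-graded bialgebras $\mathcal{B}$ and $\mathcal{B}^+$ over $\mathbb{F}_2$ are quadratic.
   Context: Bialgebras. For $n\in\mathbb{N}$ let $\mathcal{B}^+_n=\mathbb{F}_2[\alpha_1,\ldots,\alpha_n]$ and $\mathcal{B}_n=\mathcal{B}_n^+[\alpha_n^{-1}]=\mathbb{F}_2[\alpha_1,\ldots,\alpha_{n-1},\alpha_n^{\pm1}]$, with $\alpha_0=1$ (so $\mathcal{B}_0^+=\mathcal{B}_0=\mathbb{F}_2$). The coproduct components are the $\mathbb{F}_2$-algebra morphisms $\Delta_{i,j}:\mathcal{B}_{i+j}\to\mathcal{B}_i\otimes\mathcal{B}_j$ (restricting to $\mathcal{B}^+_{i+j}\to\mathcal{B}^+_i\otimes\mathcal{B}^+_j$) given by $$\Delta_{i,j}(\alpha_k)=\sum_{s+t=k,\ 0\le s\le i,\ 0\le t\le j}\alpha_s^{2^t}\otimes\alpha_t ;$$ that is, $\Delta_{i,j}(\alpha_k)$ is the coefficient of $x^{2^k}$ in the composite $f\circ g$ with $g=\sum_{s=0}^i(\alpha_s\otimes 1)x^{2^s}$ and $f=\sum_{t=0}^j(1\otimes\alpha_t)x^{2^t}$. E.g. $\Delta_{1,1}(\alpha_1)=\alpha_1\otimes1+1\otimes\alpha_1$ and $\Delta_{1,1}(\alpha_2)=\alpha_1^2\otimes\alpha_1$. The counit is the identification of the degree $0$ part with $\mathbb{F}_2$. The underlying $\mathbb{N}$-graded coalgebra is $(\mathcal{B}_n)_{n\in\mathbb{N}}$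 (resp. $(\mathcal{B}^+_n)_{n\in\mathbb{N}}$) with the coproduct $\Delta=(\Delta_{i,j})$. Quadratic coalgebras. For a field $\mathbb{K}$, a $\mathbb{K}$-vector space $V$ and a subspace $R\le V^{\otimes2}$, let $\langle V;R\rangle$ be the graded subcoalgebra of the tensor coalgebra $T_c(V)$ (where $T_c(V)_n=V^{\otimes n}$ with the deconcatenation coproduct) given by $\langle V;R\rangle_0=\mathbb{K}$, $\langle V;R\rangle_1=V$ and $\langle V;R\rangle_n=\bigcap_{i+j+2=n}V^{\otimes i}\otimes R\otimes V^{\otimes j}$ for $n\ge2$. An $\mathbb{N}$-graded (counital) coalgebra $C$ is quadratic if it is isomorphic, as a graded coalgebra, to some $\langle V;R\rangle$. *)

theory Defs
  imports Complex_Main "HOL-Library.Poly_Mapping" "HOL-Library.Product_Plus" "HOL-Library.Z2"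
begin

section \<open>Vector spaces and their tensor products\<close>

text \<open>
  Every vector space over a field has a basis, so it is isomorphic to a subspace (even the whole)
  of a space of finitely supported functions \<^typ>\<open>'a \<Rightarrow>\<^sub>0 'k\<close>. All vector spaces below are
  subspaces of such spaces.
\<close>

definition psc :: "'k::semiring_0 \<Rightarrow> ('a \<Rightarrow>\<^sub>0 'k) \<Rightarrow> ('a \<Rightarrow>\<^sub>0 'k)" where
  "psc c p = Poly_Mapping.map ((*) c) p"

lemma lookup_psc [simp]: "Poly_Mapping.lookup (psc c p) x = c * Poly_Mapping.lookup p x"
  by (simp add: psc_def Poly_Mapping.map.rep_eq when_def)

global_interpretation pm: vector_space "psc :: 'k::field \<Rightarrow> ('a \<Rightarrow>\<^sub>0 'k) \<Rightarrow> ('a \<Rightarrow>\<^sub>0 'k)"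
  by standard (auto intro!: poly_mapping_eqI simp: lookup_add algebra_simps)

definition lin_on ::
  "('k::field \<Rightarrow> 'c \<Rightarrow> 'c::ab_group_add) \<Rightarrow> ('a \<Rightarrow>\<^sub>0 'k) set \<Rightarrow> (('a \<Rightarrow>\<^sub>0 'k) \<Rightarrow> 'c) \<Rightarrow> bool" where
  "lin_on sc U f \<longleftrightarrow>
     (\<forall>x\<in>U. \<forall>y\<in>U. f (x + y) = f x + f y) \<and> (\<forall>c. \<forall>x\<in>U. f (psc c x) = sc c (f x))"

definition lin_ext :: "('k::zero \<Rightarrow> 'c \<Rightarrow> 'c::ab_group_add) \<Rightarrow> ('a \<Rightarrow> 'c) \<Rightarrow> ('a \<Rightarrow>\<^sub>0 'k) \<Rightarrow> 'c" where
  "lin_ext sc f p = (\<Sum>x\<in>Poly_Mapping.keys p. sc (Poly_Mapping.lookup p x) (f x))"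

definition push :: "('a \<Rightarrow> 'b) \<Rightarrow> ('a \<Rightarrow>\<^sub>0 'k::field) \<Rightarrow> ('b \<Rightarrow>\<^sub>0 'k)" where
  "push g = lin_ext psc (\<lambda>x. Poly_Mapping.single (g x) 1)"

text \<open>
  The tensor product of subspaces \<open>U\<close> and \<open>W\<close> is realised inside the finitely supported functions
  on pairs. The lemmas \<open>tensor_lift_exists\<close> and \<open>tensor_lift_unique\<close> below establish
  its universal property.
\<close>

definition tens :: "('a \<Rightarrow>\<^sub>0 'k::field) \<Rightarrow> ('b \<Rightarrow>\<^sub>0 'k) \<Rightarrow> ('a \<times> 'b \<Rightarrow>\<^sub>0 'k)" where
  "tens u w = (\<Sum>x\<in>Poly_Mapping.keys u. \<Sum>y\<in>Poly_Mapping.keys w. Poly_Mapping.single (x, y) (Poly_Mapping.lookup u x * Poly_Mapping.lookup w y))"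

definition tensor :: "('a \<Rightarrow>\<^sub>0 'k::field) set \<Rightarrow> ('b \<Rightarrow>\<^sub>0 'k) set \<Rightarrow> ('a \<times> 'b \<Rightarrow>\<^sub>0 'k) set" where
  "tensor U W = pm.span {tens u w | u w. u \<in> U \<and> w \<in> W}"

definition tensor_lift ::
  "('k::field \<Rightarrow> 'c \<Rightarrow> 'c::ab_group_add) \<Rightarrow> ('a \<Rightarrow>\<^sub>0 'k) set \<Rightarrow> ('b \<Rightarrow>\<^sub>0 'k) set \<Rightarrow>
   (('a \<Rightarrow>\<^sub>0 'k) \<Rightarrow> ('b \<Rightarrow>\<^sub>0 'k) \<Rightarrow> 'c) \<Rightarrow> ('a \<times> 'b \<Rightarrow>\<^sub>0 'k) \<Rightarrow> 'c" where
  "tensor_lift sc U W \<beta> =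
     (SOME h. lin_on sc (tensor U W) h \<and> (\<forall>u\<in>U. \<forall>w\<in>W. h (tens u w) = \<beta> u w))"

definition tensor_map ::
  "('a \<Rightarrow>\<^sub>0 'k::field) set \<Rightarrow> ('b \<Rightarrow>\<^sub>0 'k) set \<Rightarrow>
   (('a \<Rightarrow>\<^sub>0 'k) \<Rightarrow> ('c \<Rightarrow>\<^sub>0 'k)) \<Rightarrow> (('b \<Rightarrow>\<^sub>0 'k) \<Rightarrow> ('d \<Rightarrow>\<^sub>0 'k)) \<Rightarrow>
   ('a \<times> 'b \<Rightarrow>\<^sub>0 'k) \<Rightarrow> ('c \<times> 'd \<Rightarrow>\<^sub>0 'k)" where
  "tensor_map U W f g = tensor_lift psc U W (\<lambda>u w. tens (f u) (g w))"

lemma lookup_tens [simp]: "Poly_Mapping.lookup (tens u w) (x, y) = Poly_Mapping.lookup u x * Poly_Mapping.lookup w y"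
proof -
  have "Poly_Mapping.lookup (tens u w) (x, y) =
      (\<Sum>a\<in>Poly_Mapping.keys u. \<Sum>b\<in>Poly_Mapping.keys w. if a = x then (if b = y then Poly_Mapping.lookup u a * Poly_Mapping.lookup w b else 0) else 0)"
    unfolding tens_def lookup_sum
    by (intro sum.cong refl) (auto simp: lookup_single when_def)
  also have "\<dots> = (\<Sum>a\<in>Poly_Mapping.keys u. if a = x then \<Sum>b\<in>Poly_Mapping.keys w. if b = y then Poly_Mapping.lookup u a * Poly_Mapping.lookup w b else 0 else 0)"
    by (intro sum.cong refl) auto
  also have "\<dots> = Poly_Mapping.lookup u x * Poly_Mapping.lookup w y"
    by (auto simp: in_keys_iff)
  finally show ?thesis .
qed

lemma keys_tens: "Poly_Mapping.keys (tens u w) = Poly_Mapping.keys u \<times> Poly_Mapping.keys w"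
  by (auto simp: in_keys_iff)

lemma lin_ext_superset:
  assumes "vector_space sc" "finite S" "Poly_Mapping.keys p \<subseteq> S"
  shows "lin_ext sc f p = (\<Sum>x\<in>S. sc (Poly_Mapping.lookup p x) (f x))"
proof -
  interpret vector_space sc by fact
  show ?thesis unfolding lin_ext_def
    by (rule sum.mono_neutral_left) (use assms in \<open>auto simp: in_keys_iff\<close>)
qed

lemma lin_on_lin_ext:
  assumes "vector_space sc"
  shows "lin_on sc U (lin_ext sc f)"
proof -
  interpret vector_space sc by fact
  have "lin_ext sc f (x + y) = lin_ext sc f x + lin_ext sc f y" for x y
    using Poly_Mapping.keys_add[of x y]
    by (simp add: lin_ext_superset[OF assms, where S = "Poly_Mapping.keys x \<union> Poly_Mapping.keys y"] lookup_add
        scale_left_distrib sum.distrib)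
  moreover have "lin_ext sc f (psc c x) = sc c (lin_ext sc f x)" for c x
  proof -
    have "Poly_Mapping.keys (psc c x) \<subseteq> Poly_Mapping.keys x" by (auto simp: in_keys_iff)
    then show ?thesis
      by (simp add: lin_ext_superset[OF assms, where S = "Poly_Mapping.keys x"] scale_sum_right)
  qed
  ultimately show ?thesis by (auto simp: lin_on_def)
qed

lemma lin_on_sum:
  assumes "vector_space sc" "lin_on sc U f" "pm.subspace U" "\<And>i. i \<in> I \<Longrightarrow> v i \<in> U"
  shows "f (\<Sum>i\<in>I. psc (c i) (v i)) = (\<Sum>i\<in>I. sc (c i) (f (v i)))"
proof -
  interpret vector_space sc by fact
  have z: "f 0 = 0"
    using assms(2) pm.subspace_0[OF assms(3)] unfolding lin_on_def
    by (metis pm.scale_zero_left scale_zero_left)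
  show ?thesis using assms(4)
  proof (induction I rule: infinite_finite_induct)
    case (insert i I)
    have "(\<Sum>i\<in>I. psc (c i) (v i)) \<in> U"
      using insert by (auto intro!: pm.subspace_sum[OF assms(3)] pm.subspace_scale[OF assms(3)])
    moreover have "psc (c i) (v i) \<in> U"
      using insert by (auto intro!: pm.subspace_scale[OF assms(3)])
    ultimately show ?case using insert assms(2) by (auto simp: lin_on_def)
  qed (auto simp: z)
qed

lemma expand: "(p :: 'a \<Rightarrow>\<^sub>0 'k::field) = (\<Sum>x\<in>Poly_Mapping.keys p. psc (Poly_Mapping.lookup p x) (Poly_Mapping.single x 1))"
  by (intro poly_mapping_eqI)
     (auto simp: lookup_sum lookup_single when_def in_keys_iff if_distrib cong: if_cong)

lemma projection_exists:
  fixes U :: "('a \<Rightarrow>\<^sub>0 'k::field) set"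
  assumes "pm.subspace U"
  shows "\<exists>P. lin_on psc UNIV P \<and> (\<forall>x. P x \<in> U) \<and> (\<forall>x\<in>U. P x = x)"
proof -
  interpret vector_space_pair "psc :: 'k \<Rightarrow> ('a \<Rightarrow>\<^sub>0 'k) \<Rightarrow> ('a \<Rightarrow>\<^sub>0 'k)" "psc :: 'k \<Rightarrow> ('a \<Rightarrow>\<^sub>0 'k) \<Rightarrow> ('a \<Rightarrow>\<^sub>0 'k)"
    by standard
  have "Vector_Spaces.linear psc psc (id :: ('a \<Rightarrow>\<^sub>0 'k) \<Rightarrow> _)" by (rule pm.linear_id)
  from linear_exists_left_inverse_on[OF this assms]
  obtain g where "range g \<subseteq> U" "Vector_Spaces.linear psc psc g" "\<forall>v\<in>U. g v = v" by auto
  then show ?thesis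
    by (intro exI[of _ g]) (auto simp: lin_on_def linear_add linear_scale)
qed

text \<open>Bilinear maps on \<open>U \<times> W\<close> factor uniquely through \<^term>\<open>tensor U W\<close>.\<close>

lemma tensor_lift_exists:
  fixes \<beta> :: "('a \<Rightarrow>\<^sub>0 'k::field) \<Rightarrow> ('b \<Rightarrow>\<^sub>0 'k) \<Rightarrow> 'c::ab_group_add"
  assumes sc: "vector_space sc" and U: "pm.subspace U" and W: "pm.subspace W"
    and l: "\<And>w. w \<in> W \<Longrightarrow> lin_on sc U (\<lambda>u. \<beta> u w)"
    and r: "\<And>u. u \<in> U \<Longrightarrow> lin_on sc W (\<beta> u)"
  shows "lin_on sc (tensor U W) (tensor_lift sc U W \<beta>)"
    and "\<And>u w. u \<in> U \<Longrightarrow> w \<in> W \<Longrightarrow> tensor_lift sc U W \<beta> (tens u w) = \<beta> u w"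
proof -
  interpret vector_space sc by fact
  obtain P where P: "lin_on psc UNIV P" "\<And>x. P x \<in> U" "\<And>x. x \<in> U \<Longrightarrow> P x = x"
    using projection_exists[OF U] by blast
  obtain Q where Q: "lin_on psc UNIV Q" "\<And>x. Q x \<in> W" "\<And>x. x \<in> W \<Longrightarrow> Q x = x"
    using projection_exists[OF W] by blast
  define e where "e = (\<lambda>x. Poly_Mapping.single x (1::'k) :: 'a \<Rightarrow>\<^sub>0 'k)"
  define e' where "e' = (\<lambda>x. Poly_Mapping.single x (1::'k) :: 'b \<Rightarrow>\<^sub>0 'k)"
  define h where "h = lin_ext sc (\<lambda>(x, y). \<beta> (P (e x)) (Q (e' y)))"
  have "h (tens u w) = \<beta> u w" if u: "u \<in> U" and w: "w \<in> W" for u w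
  proof -
    have u': "u = (\<Sum>x\<in>Poly_Mapping.keys u. psc (Poly_Mapping.lookup u x) (P (e x)))"
      using lin_on_sum[OF pm.vector_space_axioms P(1) pm.subspace_UNIV, of "Poly_Mapping.keys u" e "Poly_Mapping.lookup u"]
        expand[of u] P(3)[OF u] by (simp add: e_def)
    have w': "w = (\<Sum>y\<in>Poly_Mapping.keys w. psc (Poly_Mapping.lookup w y) (Q (e' y)))"
      using lin_on_sum[OF pm.vector_space_axioms Q(1) pm.subspace_UNIV, of "Poly_Mapping.keys w" e' "Poly_Mapping.lookup w"]
        expand[of w] Q(3)[OF w] by (simp add: e'_def)
    have "\<beta> u w = (\<Sum>x\<in>Poly_Mapping.keys u. sc (Poly_Mapping.lookup u x) (\<beta> (P (e x)) w))"
      by (subst u') (rule lin_on_sum[OF sc l[OF w] U P(2)])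
    also have "\<dots> = (\<Sum>x\<in>Poly_Mapping.keys u. sc (Poly_Mapping.lookup u x) (\<Sum>y\<in>Poly_Mapping.keys w. sc (Poly_Mapping.lookup w y) (\<beta> (P (e x)) (Q (e' y)))))"
      by (subst w', subst lin_on_sum[OF sc r[OF P(2)] W Q(2)]) (rule refl)
    also have "\<dots> = h (tens u w)"
      by (auto simp: h_def lin_ext_def keys_tens sum.cartesian_product scale_sum_right intro!: sum.cong)
    finally show ?thesis by simp
  qed
  moreover have "lin_on sc (tensor U W) h"
    unfolding h_def by (rule lin_on_lin_ext[OF sc])
  ultimately have "\<exists>h. lin_on sc (tensor U W) h \<and> (\<forall>u\<in>U. \<forall>w\<in>W. h (tens u w) = \<beta> u w)"
    by blast
  from someI_ex[OF this] show "lin_on sc (tensor U W) (tensor_lift sc U W \<beta>)"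
    and "\<And>u w. u \<in> U \<Longrightarrow> w \<in> W \<Longrightarrow> tensor_lift sc U W \<beta> (tens u w) = \<beta> u w"
    unfolding tensor_lift_def by blast+
qed

lemma tensor_lift_unique:
  assumes sc: "vector_space sc" and h: "lin_on sc (tensor U W) h" and h': "lin_on sc (tensor U W) h'"
    and eq: "\<And>u w. u \<in> U \<Longrightarrow> w \<in> W \<Longrightarrow> h (tens u w) = h' (tens u w)" and t: "t \<in> tensor U W"
  shows "h t = h' t"
proof -
  interpret vector_space sc by fact
  obtain S r where S: "S \<subseteq> {tens u w | u w. u \<in> U \<and> w \<in> W}" "t = (\<Sum>a\<in>S. psc (r a) a)"
    using t unfolding tensor_def pm.span_explicit by blast
  have sub: "pm.subspace (tensor U W)" unfolding tensor_def by (rule pm.subspace_span)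
  have mem: "\<And>a. a \<in> S \<Longrightarrow> a \<in> tensor U W"
    using S(1) unfolding tensor_def by (blast intro: pm.span_base)
  have "h t = (\<Sum>a\<in>S. sc (r a) (h a))" "h' t = (\<Sum>a\<in>S. sc (r a) (h' a))"
    unfolding S(2) by (rule lin_on_sum[OF sc h sub mem], simp) (rule lin_on_sum[OF sc h' sub mem], simp)
  moreover have "h a = h' a" if "a \<in> S" for a using that S(1) eq by auto
  ultimately show ?thesis by simp
qed


section \<open>Graded coalgebras\<close>

text \<open>
  The grading is external: the pieces are a family of vector spaces, which may overlap as sets.
  The counit is given by its restriction to the piece of degree 0.
\<close>

record (overloaded) ('a, 'k) gcoalg =
  piece :: "nat \<Rightarrow> ('a \<Rightarrow>\<^sub>0 'k) set"
  coprod :: "nat \<Rightarrow> nat \<Rightarrow> ('a \<Rightarrow>\<^sub>0 'k) \<Rightarrow> ('a \<times> 'a \<Rightarrow>\<^sub>0 'k)"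
  counit :: "('a \<Rightarrow>\<^sub>0 'k) \<Rightarrow> 'k"

definition graded_coalgebra :: "('a, 'k::field) gcoalg \<Rightarrow> bool" where
  "graded_coalgebra C \<longleftrightarrow>
     (\<forall>n. pm.subspace (piece C n)) \<and>
     (\<forall>i j. lin_on psc (piece C (i + j)) (coprod C i j)) \<and>
     (\<forall>i j. \<forall>x\<in>piece C (i + j). coprod C i j x \<in> tensor (piece C i) (piece C j)) \<and>
     lin_on (*) (piece C 0) (counit C) \<and>
     (\<forall>i j k. \<forall>x\<in>piece C (i + j + k).
        push (\<lambda>((a, b), c). (a, (b, c)))
          (tensor_map (piece C (i + j)) (piece C k) (coprod C i j) id (coprod C (i + j) k x)) =
        tensor_map (piece C i) (piece C (j + k)) id (coprod C j k) (coprod C i (j + k) x)) \<and>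
     (\<forall>n. \<forall>x\<in>piece C n.
        tensor_lift psc (piece C 0) (piece C n) (\<lambda>u w. psc (counit C u) w) (coprod C 0 n x) = x \<and>
        tensor_lift psc (piece C n) (piece C 0) (\<lambda>u w. psc (counit C w) u) (coprod C n 0 x) = x)"

definition gcoalg_iso ::
  "('a, 'k::field) gcoalg \<Rightarrow> ('b, 'k) gcoalg \<Rightarrow> (nat \<Rightarrow> ('a \<Rightarrow>\<^sub>0 'k) \<Rightarrow> ('b \<Rightarrow>\<^sub>0 'k)) \<Rightarrow> bool" where
  "gcoalg_iso C D \<phi> \<longleftrightarrow>
     (\<forall>n. lin_on psc (piece C n) (\<phi> n) \<and> bij_betw (\<phi> n) (piece C n) (piece D n)) \<and>
     (\<forall>i j. \<forall>x\<in>piece C (i + j).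
        tensor_map (piece C i) (piece C j) (\<phi> i) (\<phi> j) (coprod C i j x) =
        coprod D i j (\<phi> (i + j) x)) \<and>
     (\<forall>x\<in>piece C 0. counit D (\<phi> 0 x) = counit C x)"


section \<open>The tensor coalgebra and quadratic coalgebras\<close>

text \<open>
  For a subspace \<open>V\<close> of \<^typ>\<open>'a \<Rightarrow>\<^sub>0 'k\<close>, the tensor powers of \<open>V\<close> are realised inside the finitely
  supported functions on words; \<open>cat\<close> extends concatenation of words bilinearly and thus identifies
  \<^term>\<open>tensor\<close> products of spaces of homogeneous words with spaces of longer words.
\<close>

definition cat :: "('a list \<Rightarrow>\<^sub>0 'k::field) \<Rightarrow> ('a list \<Rightarrow>\<^sub>0 'k) \<Rightarrow> ('a list \<Rightarrow>\<^sub>0 'k)" where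
  "cat u w = push (\<lambda>(x, y). x @ y) (tens u w)"

definition cat_space ::
  "('a list \<Rightarrow>\<^sub>0 'k::field) set \<Rightarrow> ('a list \<Rightarrow>\<^sub>0 'k) set \<Rightarrow> ('a list \<Rightarrow>\<^sub>0 'k) set" where
  "cat_space A B = pm.span {cat a b | a b. a \<in> A \<and> b \<in> B}"

definition letters :: "('a \<Rightarrow>\<^sub>0 'k::field) set \<Rightarrow> ('a list \<Rightarrow>\<^sub>0 'k) set" where
  "letters V = push (\<lambda>x. [x]) ` V"

primrec tpow :: "('a \<Rightarrow>\<^sub>0 'k::field) set \<Rightarrow> nat \<Rightarrow> ('a list \<Rightarrow>\<^sub>0 'k) set" where
  "tpow V 0 = pm.span {Poly_Mapping.single [] 1}"
| "tpow V (Suc n) = cat_space (letters V) (tpow V n)"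

definition tensor_coalgebra :: "('a \<Rightarrow>\<^sub>0 'k::field) set \<Rightarrow> ('a list, 'k) gcoalg" where
  "tensor_coalgebra V =
     \<lparr>piece = tpow V,
      coprod = (\<lambda>i j. push (\<lambda>w. (take i w, drop i w))),
      counit = (\<lambda>u. Poly_Mapping.lookup u [])\<rparr>"

definition quadratic_piece ::
  "('a \<Rightarrow>\<^sub>0 'k::field) set \<Rightarrow> ('a list \<Rightarrow>\<^sub>0 'k) set \<Rightarrow> nat \<Rightarrow> ('a list \<Rightarrow>\<^sub>0 'k) set" where
  "quadratic_piece V R n =
     (if n < 2 then tpow V n
      else \<Inter>{cat_space (tpow V i) (cat_space R (tpow V j)) | i j. i + j + 2 = n})"

definition quadratic_coalgebra ::
  "('a \<Rightarrow>\<^sub>0 'k::field) set \<Rightarrow> ('a list \<Rightarrow>\<^sub>0 'k) set \<Rightarrow> ('a list, 'k) gcoalg" where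
  "quadratic_coalgebra V R = (tensor_coalgebra V)\<lparr>piece := quadratic_piece V R\<rparr>"

text \<open>
  An isomorphism forces \<open>V\<close> to be isomorphic to the degree 1 piece of \<open>C\<close>, so it is no restriction
  to look for \<open>V\<close> among the subspaces of the same \<^typ>\<open>'a \<Rightarrow>\<^sub>0 'k\<close>.
\<close>

definition quadratic :: "('a, 'k::field) gcoalg \<Rightarrow> bool" where
  "quadratic C \<longleftrightarrow> graded_coalgebra C \<and>
     (\<exists>V R \<phi>. pm.subspace (V :: ('a \<Rightarrow>\<^sub>0 'k) set) \<and> pm.subspace R \<and> R \<subseteq> tpow V 2 \<and>
        gcoalg_iso C (quadratic_coalgebra V R) \<phi>)"


section \<open>The coalgebras underlying the two bialgebras\<close>

text \<open>
  \<open>laurent\<close> is the Laurent polynomial ring over \<open>\<bbbF>\<^sub>2\<close> in the variables \<open>\<alpha>\<^sub>k\<close>, \<open>k :: nat\<close> (as a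
  monoid algebra). The variable of index 0 is never used, as \<open>\<alpha>\<^sub>0 = 1\<close>.
  With the componentwise addition on pairs of exponents, \<open>laurent2\<close> is its tensor square as
  a ring (see \<open>tens_mult\<close>).
\<close>

type_synonym laurent = "(nat \<Rightarrow>\<^sub>0 int) \<Rightarrow>\<^sub>0 bit"
type_synonym laurent2 = "(nat \<Rightarrow>\<^sub>0 int) \<times> (nat \<Rightarrow>\<^sub>0 int) \<Rightarrow>\<^sub>0 bit"

definition \<alpha> :: "nat \<Rightarrow> laurent" where
  "\<alpha> k = (if k = 0 then 1 else Poly_Mapping.single (Poly_Mapping.single k 1) 1)"

definition Bplus :: "nat \<Rightarrow> laurent set" where
  "Bplus n = {p. \<forall>m\<in>Poly_Mapping.keys p. Poly_Mapping.keys m \<subseteq> {1..n} \<and> (\<forall>k. Poly_Mapping.lookup m k \<ge> 0)}"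

definition B :: "nat \<Rightarrow> laurent set" where
  "B n = {p. \<forall>m\<in>Poly_Mapping.keys p. Poly_Mapping.keys m \<subseteq> {1..n} \<and> (\<forall>k<n. Poly_Mapping.lookup m k \<ge> 0)}"

definition \<Delta>_gen :: "nat \<Rightarrow> nat \<Rightarrow> nat \<Rightarrow> laurent2" where
  "\<Delta>_gen i j k = (\<Sum>(s, t)\<in>{(s, t). s + t = k \<and> s \<le> i \<and> t \<le> j}. tens (\<alpha> s ^ (2 ^ t)) (\<alpha> t))"

text \<open>Integer powers in a commutative ring; negative ones are only meaningful for units.\<close>

definition ipow :: "'r::comm_ring_1 \<Rightarrow> int \<Rightarrow> 'r" where
  "ipow z e = (if e \<ge> 0 then z ^ nat e else (THE y. z * y = 1) ^ nat (- e))"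

definition \<Delta> :: "nat \<Rightarrow> nat \<Rightarrow> laurent \<Rightarrow> laurent2" where
  "\<Delta> i j = lin_ext psc (\<lambda>m. \<Prod>k\<in>{1..i + j}. ipow (\<Delta>_gen i j k) (Poly_Mapping.lookup m k))"

definition B_coalg :: "(nat \<Rightarrow>\<^sub>0 int, bit) gcoalg" where
  "B_coalg = \<lparr>piece = B, coprod = \<Delta>, counit = (\<lambda>p. Poly_Mapping.lookup p 0)\<rparr>"

definition Bplus_coalg :: "(nat \<Rightarrow>\<^sub>0 int, bit) gcoalg" where
  "Bplus_coalg = \<lparr>piece = Bplus, coprod = \<Delta>, counit = (\<lambda>p. Poly_Mapping.lookup p 0)\<rparr>"

subsection \<open>\<open>\<Delta> i j\<close> is the algebra morphism on \<open>B (i + j)\<close> with the prescribed values\<close>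

lemma psc_mult: "psc a p * psc b q = psc (a * b) (p * q)"
  for p q :: "'a::comm_monoid_add \<Rightarrow>\<^sub>0 'k::field"
proof -
  have "psc a p * psc b q = (Poly_Mapping.single 0 a * Poly_Mapping.single 0 b) * (p * q)"
    unfolding psc_def mult_map_scale_conv_mult by (simp only: ac_simps)
  also have "\<dots> = psc (a * b) (p * q)"
    unfolding psc_def mult_map_scale_conv_mult by (simp add: mult_single)
  finally show ?thesis .
qed

lemma psc_single_1: "psc c (Poly_Mapping.single x 1) = Poly_Mapping.single x (c::'k::field)"
  by (rule poly_mapping_eqI) (simp add: lookup_single when_def)

lemma pm_additive_induct:
  assumes "\<And>x c. P (Poly_Mapping.single x (c::'k::field))"
    and "\<And>p q. P p \<Longrightarrow> P q \<Longrightarrow> P (p + q)"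
  shows "P p"
proof -
  have "P (\<Sum>x\<in>S. Poly_Mapping.single x (Poly_Mapping.lookup p x))" for S
    by (induction S rule: infinite_finite_induct) (use assms assms(1)[of _ 0] in auto)
  from this[of "Poly_Mapping.keys p"] show ?thesis
    by (metis (mono_tags, lifting) psc_single_1 expand sum.cong)
qed

lemma tens_add_left: "tens (a + b) c = tens a c + tens b c"
  and tens_add_right: "tens c (a + b) = tens c a + tens c b"
  by (rule poly_mapping_eqI, auto simp: lookup_add algebra_simps)+

lemma tens_single:
  "tens (Poly_Mapping.single x a) (Poly_Mapping.single y b) = Poly_Mapping.single (x, y) (a * b)"
  by (rule poly_mapping_eqI) (auto simp: lookup_single when_def split: if_splits)

lemma tens_mult:
  fixes a b :: "'a::comm_monoid_add \<Rightarrow>\<^sub>0 'k::field" and c d :: "'b::comm_monoid_add \<Rightarrow>\<^sub>0 'k"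
  shows "tens a c * tens b d = tens (a * b) (c * d)"
proof (induction a rule: pm_additive_induct)
  case (1 x e) show ?case
  proof (induction b rule: pm_additive_induct)
    case (1 x' e') show ?case
    proof (induction c rule: pm_additive_induct)
      case (1 y g) show ?case
        by (induction d rule: pm_additive_induct)
           (simp_all add: tens_single mult_single ac_simps tens_add_right distrib_left distrib_right)
    qed (simp add: tens_add_right distrib_right)
  qed (simp add: tens_add_left distrib_left)
qed (simp add: tens_add_left distrib_right)

lemma tens_power: "tens a c ^ n = tens (a ^ n) (c ^ n)"
  for a :: "'a::comm_monoid_add \<Rightarrow>\<^sub>0 'k::field" and c :: "'b::comm_monoid_add \<Rightarrow>\<^sub>0 'k"
proof (induction n)
  case 0
  have "tens (1 :: 'a \<Rightarrow>\<^sub>0 'k) (1 :: 'b \<Rightarrow>\<^sub>0 'k) = 1"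
    by (simp add: tens_single zero_prod_def flip: single_one)
  then show ?case by simp
qed (simp add: tens_mult)

lemma ipow_unit:
  assumes "z * y = (1 :: 'r::comm_ring_1)"
  shows "ipow z (a + b) = ipow z a * ipow z b"
proof -
  have u: "w = y" if "z * w = 1" for w
    using that assms by (metis mult.assoc mult.commute mult_1)
  have inv: "(THE y. z * y = 1) = y"
    by (rule the_equality) (rule assms, rule u)
  have c: "z ^ (m + n) * y ^ n = z ^ m" for m n
  proof -
    have "z ^ (m + n) * y ^ n = z ^ m * (z * y) ^ n"
      by (simp only: power_add power_mult_distrib mult.assoc)
    then show ?thesis by (simp add: assms)
  qed
  have c': "z ^ n * y ^ (m + n) = y ^ m" for m n
  proof -
    have "z ^ n * y ^ (m + n) = y ^ m * (z * y) ^ n"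
      by (simp only: power_add power_mult_distrib ac_simps)
    then show ?thesis by (simp add: assms)
  qed
  have i: "ipow z (int m - int n) = z ^ m * y ^ n" for m n
  proof (cases "m \<ge> n")
    case True
    then show ?thesis using c[of "m - n" n] by (simp add: ipow_def nat_diff_distrib)
  next
    case False
    then have "ipow z (int m - int n) = y ^ (n - m)"
      by (simp add: ipow_def inv nat_diff_distrib)
    then show ?thesis using False c'[of m "n - m"] by simp
  qed
  obtain m n where a: "a = int m - int n" by (metis int_diff_cases)
  obtain m' n' where b: "b = int m' - int n'" by (metis int_diff_cases)
  have "ipow z (a + b) = ipow z (int (m + m') - int (n + n'))" by (simp add: a b algebra_simps)
  then show ?thesis unfolding i a b by (simp only: power_add ac_simps)
qed

lemma ipow_nonneg: "a \<ge> 0 \<Longrightarrow> b \<ge> 0 \<Longrightarrow> ipow z (a + b) = ipow z a * ipow z b"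
  by (simp add: ipow_def nat_add_distrib power_add)

lemma \<alpha>_unit: "\<exists>y. \<alpha> k * y = 1"
proof (cases "k = 0")
  case False
  have "\<alpha> k * Poly_Mapping.single (Poly_Mapping.single k (- 1)) 1 = 1"
    using False by (simp add: \<alpha>_def mult_single flip: single_add single_one)
  then show ?thesis by blast
qed (simp add: \<alpha>_def)

lemma \<Delta>_gen_top: "\<Delta>_gen i j (i + j) = tens (\<alpha> i ^ (2 ^ j)) (\<alpha> j)"
proof -
  have "{(s, t). s + t = i + j \<and> s \<le> i \<and> t \<le> j} = {(i, j)}" by auto
  then show ?thesis by (simp add: \<Delta>_gen_def)
qed

lemma \<Delta>_gen_top_unit: "\<exists>y. \<Delta>_gen i j (i + j) * y = 1"
proof -
  obtain y z where "\<alpha> i * y = 1" "\<alpha> j * z = 1" using \<alpha>_unit by meson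
  then have "\<Delta>_gen i j (i + j) * tens (y ^ (2 ^ j)) z = tens 1 1"
    by (simp add: \<Delta>_gen_top tens_mult flip: power_mult_distrib)
  moreover have "tens 1 1 = (1 :: laurent2)" using tens_power[of 1 1 0] by simp
  ultimately show ?thesis by metis
qed

lemma \<Delta>_add: "\<Delta> i j (p + q) = \<Delta> i j p + \<Delta> i j q"
  unfolding \<Delta>_def
  using lin_on_lin_ext[OF pm.vector_space_axioms, of UNIV] unfolding lin_on_def by blast

lemma \<Delta>_single:
  "\<Delta> i j (Poly_Mapping.single m c) =
     psc c (\<Prod>k\<in>{1..i + j}. ipow (\<Delta>_gen i j k) (Poly_Mapping.lookup m k))"
  unfolding \<Delta>_def by (subst lin_ext_superset[OF pm.vector_space_axioms, of "{m}"]) auto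

lemma \<Delta>_1: "\<Delta> i j 1 = 1"
proof -
  have "\<Delta> i j (Poly_Mapping.single 0 1) = 1"
    unfolding \<Delta>_single by (simp add: ipow_def)
  then show ?thesis by simp
qed

lemma \<Delta>_\<alpha>:
  assumes "k \<le> i + j"
  shows "\<Delta> i j (\<alpha> k) = \<Delta>_gen i j k"
proof (cases "k = 0")
  case True
  have "{(s, t). s + t = (0::nat) \<and> s \<le> i \<and> t \<le> j} = {(0, 0)}" by auto
  then have "\<Delta>_gen i j 0 = tens (1 :: laurent) (1 :: laurent)" by (simp add: \<Delta>_gen_def \<alpha>_def)
  also have "\<dots> = 1" using tens_power[of 1 1 0] by simp
  finally show ?thesis using True \<Delta>_1 by (simp add: \<alpha>_def)
next
  case False
  have "(\<Prod>l\<in>{1..i + j}. ipow (\<Delta>_gen i j l) (Poly_Mapping.lookup (Poly_Mapping.single k 1) l)) =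
        (\<Prod>l\<in>{1..i + j}. if l = k then \<Delta>_gen i j k else 1)"
    by (intro prod.cong refl) (auto simp: lookup_single when_def ipow_def)
  also have "\<dots> = \<Delta>_gen i j k" using assms False by auto
  finally show ?thesis using False by (simp add: \<alpha>_def \<Delta>_single)
qed

lemma \<Delta>_mult:
  assumes "p \<in> B (i + j)" "q \<in> B (i + j)"
  shows "\<Delta> i j (p * q) = \<Delta> i j p * \<Delta> i j q"
proof -
  have mono: "\<Delta> i j (Poly_Mapping.single m c * Poly_Mapping.single m' c') =
      \<Delta> i j (Poly_Mapping.single m c) * \<Delta> i j (Poly_Mapping.single m' c')"
    if "m \<in> Poly_Mapping.keys p" "m' \<in> Poly_Mapping.keys q" for m m' c c'
  proof -
    have "ipow (\<Delta>_gen i j k) (Poly_Mapping.lookup (m + m') k) =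
        ipow (\<Delta>_gen i j k) (Poly_Mapping.lookup m k) * ipow (\<Delta>_gen i j k) (Poly_Mapping.lookup m' k)"
      if "k \<in> {1..i + j}" for k
    proof (cases "k = i + j")
      case True
      then show ?thesis using \<Delta>_gen_top_unit[of i j] ipow_unit by (metis lookup_add)
    next
      case False
      then show ?thesis
        using that assms \<open>m \<in> Poly_Mapping.keys p\<close> \<open>m' \<in> Poly_Mapping.keys q\<close>
        by (auto simp: B_def lookup_add intro!: ipow_nonneg)
    qed
    then have "(\<Prod>k\<in>{1..i + j}. ipow (\<Delta>_gen i j k) (Poly_Mapping.lookup (m + m') k)) =
        (\<Prod>k\<in>{1..i + j}. ipow (\<Delta>_gen i j k) (Poly_Mapping.lookup m k)) *
        (\<Prod>k\<in>{1..i + j}. ipow (\<Delta>_gen i j k) (Poly_Mapping.lookup m' k))"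
      by (simp add: prod.distrib)
    then show ?thesis by (simp add: mult_single \<Delta>_single psc_mult)
  qed
  have sum: "\<Delta> i j (\<Sum>x\<in>S. f x) = (\<Sum>x\<in>S. \<Delta> i j (f x))" if "finite S" for S :: "(nat \<Rightarrow>\<^sub>0 int) set" and f
  proof -
    have "\<Delta> i j 0 = 0" using \<Delta>_add[of i j 0 0] by simp
    with that show ?thesis by (induction S rule: finite_induct) (auto simp: \<Delta>_add)
  qed
  have e: "r = (\<Sum>m\<in>Poly_Mapping.keys r. Poly_Mapping.single m (Poly_Mapping.lookup r m))" for r :: laurent
    using expand[of r, unfolded psc_single_1] .
  let ?P = "\<lambda>m. Poly_Mapping.single m (Poly_Mapping.lookup p m)"
  let ?Q = "\<lambda>m. Poly_Mapping.single m (Poly_Mapping.lookup q m)"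
  have "\<Delta> i j (p * q) =
      \<Delta> i j ((\<Sum>m\<in>Poly_Mapping.keys p. ?P m) * (\<Sum>m\<in>Poly_Mapping.keys q. ?Q m))"
    by (rule arg_cong[of _ _ "\<Delta> i j"], rule arg_cong2[of _ _ _ _ "(*)"], rule e, rule e)
  also have "\<dots> = (\<Sum>m\<in>Poly_Mapping.keys p. \<Sum>m'\<in>Poly_Mapping.keys q. \<Delta> i j (?P m) * \<Delta> i j (?Q m'))"
    by (simp only: sum_product sum finite_keys mono cong: sum.cong)
  also have "\<dots> = (\<Sum>m\<in>Poly_Mapping.keys p. \<Delta> i j (?P m)) * (\<Sum>m\<in>Poly_Mapping.keys q. \<Delta> i j (?Q m))"
    by (rule sum_product[symmetric])
  also have "(\<Sum>m\<in>Poly_Mapping.keys p. \<Delta> i j (?P m)) = \<Delta> i j p"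
    using sum[of "Poly_Mapping.keys p" ?P] arg_cong[OF e[of p], of "\<Delta> i j"] by (simp only: finite_keys)
  also have "(\<Sum>m\<in>Poly_Mapping.keys q. \<Delta> i j (?Q m)) = \<Delta> i j q"
    using sum[of "Poly_Mapping.keys q" ?Q] arg_cong[OF e[of q], of "\<Delta> i j"] by (simp only: finite_keys)
  finally show ?thesis .
qed

end

theory Submission
  imports Defs
begin

text \<open>
  Iterating the coproduct embeds \<open>B n\<close> into the \<open>n\<close>-th tensor power of \<open>B 1\<close>, which is the Laurent
  polynomial ring in \<open>n\<close> variables. For the lexicographic order the image of a monomial
  \<open>\<alpha>\<^sub>1\<^bsup>a\<^sub>1\<^esup> \<dots> \<alpha>\<^sub>n\<^bsup>a\<^sub>n\<^esup>\<close> has the leading exponent \<open>e\<close> with \<open>e\<^sub>i - 2 e\<^sub>i\<^sub>+\<^sub>1 = a\<^sub>i\<close> (where \<open>e\<^sub>n\<^sub>+\<^sub>1 = 0\<close>). Hence the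
  iterated coproduct is injective, which also yields coassociativity, and the leading exponents of
  its image are exactly the \<open>e\<close> with \<open>e\<^sub>i \<ge> 2 e\<^sub>i\<^sub>+\<^sub>1\<close> for \<open>0 < i < n\<close>. With \<open>R\<close> the image of \<open>B 2\<close>, each
  of these inequalities follows from the relation at the positions \<open>i, i + 1\<close> alone: restricting a
  tensor to the words that agree with its leading one outside of these positions gives an element
  of \<open>R\<close>. So a tensor satisfying all relations can be reduced to \<open>0\<close> by subtracting images of
  monomials. The exponents stay bounded below, so the descent terminates; starting from
  nonnegative exponents it only uses \<open>Bplus n\<close>.
\<close>


section \<open>Linear maps on spaces of finitely supported functions\<close>

text \<open>Two facts about \<open>iter_\<alpha>\<close> carry the argument. The top element
  \<open>iter_\<alpha> n n\<close> is a single monomial, hence a unit, so the iterated coproduct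
  makes sense on negative powers of \<open>\<alpha> n\<close>. And the leading exponent of
  \<open>iter_\<alpha> n k\<close> is \<open>cvec k\<close>, with entries
  \<open>2 ^ (k - i)\<close>. The vectors \<open>cvec 1\<close>, ..., \<open>cvec n\<close> form a
  triangular system with diagonal 1, so every integral exponent vector is a unique integral
  combination of them, and only the signs of the coefficients remain to be controlled. The last
  coefficient is free in \<open>B n\<close>, which is why there is no inequality at
  \<open>i = n\<close>; the other signs are seen by the relations of \<open>B 2\<close>.
  Nonnegativity of the last exponent in \<open>Bplus n\<close> is a matter of supports, so one
  descent with a lower bound \<open>N\<close> serves both coalgebras, \<open>Bplus\<close> being the
  case \<open>N = 0\<close>. To keep clear of the choice in \<open>tensor_lift\<close>, all maps are
  linear on the whole space, and identities between them are checked on coordinate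
  subspaces.\<close>

abbreviation lin :: "(('a \<Rightarrow>\<^sub>0 'k::field) \<Rightarrow> ('b \<Rightarrow>\<^sub>0 'k)) \<Rightarrow> bool" where
  "lin \<equiv> lin_on psc UNIV"

lemma lin_iff_linear: "lin f \<longleftrightarrow> Vector_Spaces.linear psc psc f"
  by (auto simp: lin_on_def Vector_Spaces.linear_iff pm.vector_space_axioms)

lemma lin_on_mono: "lin_on sc V f \<Longrightarrow> U \<subseteq> V \<Longrightarrow> lin_on sc U f"
  unfolding lin_on_def by blast

lemma lin_add: "lin f \<Longrightarrow> f (x + y) = f x + f y"
  and lin_psc: "lin f \<Longrightarrow> f (psc c x) = psc c (f x)"
  by (auto simp: lin_on_def)

lemma lin_0: "lin f \<Longrightarrow> f 0 = 0"
  using lin_psc[of f 0 0] by simp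

lemma lin_uminus: "lin f \<Longrightarrow> f (- x) = - f x"
  by (metis lin_add lin_0 add.right_inverse minus_unique)

lemma lin_diff: "lin f \<Longrightarrow> f (x - y) = f x - f y"
  using lin_add[of f x "- y"] by (simp add: lin_uminus)

lemma lin_sum: "lin f \<Longrightarrow> f (\<Sum>i\<in>I. v i) = (\<Sum>i\<in>I. f (v i))"
  by (induction I rule: infinite_finite_induct) (auto simp: lin_0 lin_add)

lemma lin_comp: "lin f \<Longrightarrow> lin g \<Longrightarrow> lin (\<lambda>x. f (g x))"
  by (auto simp: lin_on_def)

lemma lin_id: "lin (\<lambda>x. x)" "lin id"
  by (auto simp: lin_on_def)

lemma lin_lin_ext: "lin (lin_ext psc g)"
  by (rule lin_on_lin_ext) (rule pm.vector_space_axioms)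

lemma lin_push: "lin (push g)"
  unfolding push_def by (rule lin_lin_ext)

lemma lin_ext_single: "lin_ext psc f (Poly_Mapping.single x (1::'k::field)) = f x"
  by (simp add: lin_ext_def)

lemma push_single: "push g (Poly_Mapping.single x c) = Poly_Mapping.single (g x) c"
  using lin_psc[OF lin_push, of g c "Poly_Mapping.single x 1"]
  by (simp add: push_def lin_ext_single psc_single_1)

lemma lin_expand:
  assumes "lin f"
  shows "f p = (\<Sum>x\<in>Poly_Mapping.keys p. psc (Poly_Mapping.lookup p x) (f (Poly_Mapping.single x 1)))"
  by (subst (1) expand[of p]) (simp add: lin_sum[OF assms] lin_psc[OF assms])

text \<open>Linear maps are determined by their values on unit vectors. Comparing only those in the
  support of \<open>p\<close> also covers maps that agree merely on a coordinate subspace.\<close>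

lemma lin_eq_on_keys:
  assumes "lin f" "lin g"
    and "\<And>x. x \<in> Poly_Mapping.keys p \<Longrightarrow> f (Poly_Mapping.single x 1) = g (Poly_Mapping.single x 1)"
  shows "f p = g p"
  unfolding lin_expand[OF assms(1), of p] lin_expand[OF assms(2), of p]
  by (intro sum.cong refl) (simp add: assms(3))

lemma lin_mem_subspace:
  assumes "lin f" "pm.subspace U"
    and "\<And>x. x \<in> Poly_Mapping.keys p \<Longrightarrow> f (Poly_Mapping.single x 1) \<in> U"
  shows "f p \<in> U"
  unfolding lin_expand[OF assms(1), of p]
  by (intro pm.subspace_sum pm.subspace_scale assms)

lemma lin_image_subspace:
  fixes f :: "('b \<Rightarrow>\<^sub>0 'a::field) \<Rightarrow> ('c \<Rightarrow>\<^sub>0 'a)"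
  assumes "lin f" "pm.subspace U"
  shows "pm.subspace (f ` U)"
proof -
  interpret vector_space_pair "psc :: 'a \<Rightarrow> ('b \<Rightarrow>\<^sub>0 'a) \<Rightarrow> _" "psc :: 'a \<Rightarrow> ('c \<Rightarrow>\<^sub>0 'a) \<Rightarrow> _"
    by standard
  show ?thesis using assms by (auto simp: lin_iff_linear intro: linear_subspace_image)
qed

lemma push_push: "push g (push h p) = push (\<lambda>x. g (h x)) p"
  by (rule lin_eq_on_keys[where p = p])
     (auto intro!: lin_push lin_comp[OF lin_push lin_push] simp: push_single)

lemma push_ident: "(\<And>x. x \<in> Poly_Mapping.keys p \<Longrightarrow> g x = x) \<Longrightarrow> push g p = p"
  by (rule lin_eq_on_keys[OF lin_push lin_id(1)]) (simp add: push_single)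

lemma keys_push: "Poly_Mapping.keys (push g p) \<subseteq> g ` Poly_Mapping.keys p"
  unfolding push_def lin_ext_def psc_single_1
  using keys_sum[of "\<lambda>x. Poly_Mapping.single (g x) (Poly_Mapping.lookup p x)" "Poly_Mapping.keys p"]
  by (auto split: if_splits)

lemma lookup_push_inj:
  assumes "inj_on g S" "Poly_Mapping.keys p \<subseteq> S" "x \<in> S"
  shows "Poly_Mapping.lookup (push g p) (g x) = Poly_Mapping.lookup p x"
proof -
  have "Poly_Mapping.lookup (push g p) (g x) =
      (\<Sum>y\<in>Poly_Mapping.keys p. if y = x then Poly_Mapping.lookup p y else 0)"
    unfolding push_def lin_ext_def psc_single_1 lookup_sum
    by (intro sum.cong refl) (use assms in \<open>auto simp: lookup_single when_def dest: inj_onD\<close>)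
  then show ?thesis by (auto simp: in_keys_iff)
qed

lemma inj_on_linI:
  assumes "lin f" "pm.subspace U" "\<And>x. x \<in> U \<Longrightarrow> f x = 0 \<Longrightarrow> x = 0"
  shows "inj_on f U"
  by (rule inj_onI)
     (metis assms(3) lin_diff[OF assms(1)] pm.subspace_diff[OF assms(2)] right_minus_eq)

lemma lin_left_inverse:
  fixes f :: "('b \<Rightarrow>\<^sub>0 'a::field) \<Rightarrow> ('c \<Rightarrow>\<^sub>0 'a)"
  assumes "lin f" "pm.subspace U" "inj_on f U"
  obtains g where "lin g" "\<And>x. x \<in> U \<Longrightarrow> g (f x) = x"
proof -
  interpret vector_space_pair "psc :: 'a \<Rightarrow> ('b \<Rightarrow>\<^sub>0 'a) \<Rightarrow> _" "psc :: 'a \<Rightarrow> ('c \<Rightarrow>\<^sub>0 'a) \<Rightarrow> _"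
    by standard
  show ?thesis
    using that linear_exists_left_inverse_on[of f U] assms by (auto simp: lin_iff_linear)
qed


subsection \<open>Coordinate subspaces and tensor products of linear maps\<close>

text \<open>Monomials and words are basis vectors, so \<open>B n\<close>, \<open>Bplus n\<close> and
  their tensor powers are all of this kind; inclusions and tensor products then reduce to index
  sets.\<close>

definition coord_space :: "'a set \<Rightarrow> ('a \<Rightarrow>\<^sub>0 'k::field) set" where
  "coord_space S = {p. Poly_Mapping.keys p \<subseteq> S}"

lemma coord_space_subspace: "pm.subspace (coord_space S :: ('a \<Rightarrow>\<^sub>0 'b::field) set)"
proof (rule pm.subspaceI)
  fix p q :: "'a \<Rightarrow>\<^sub>0 'b" assume "p \<in> coord_space S" "q \<in> coord_space S"
  then show "p + q \<in> coord_space S" using Poly_Mapping.keys_add[of p q] by (auto simp: coord_space_def)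
next
  fix p :: "'a \<Rightarrow>\<^sub>0 'b" and c assume "p \<in> coord_space S"
  then show "psc c p \<in> coord_space S" by (auto simp: coord_space_def in_keys_iff)
qed (auto simp: coord_space_def)

lemma coord_space_mono: "S \<subseteq> T \<Longrightarrow> coord_space S \<subseteq> coord_space T"
  by (auto simp: coord_space_def)

lemma single_in_coord_space [simp]: "Poly_Mapping.single x 1 \<in> coord_space S \<longleftrightarrow> x \<in> S"
  by (auto simp: coord_space_def)

lemma coord_spaceD: "p \<in> coord_space S \<Longrightarrow> x \<in> Poly_Mapping.keys p \<Longrightarrow> x \<in> S"
  by (auto simp: coord_space_def)

lemma lin_coord_space:
  assumes "lin f" "pm.subspace U" "\<And>x. x \<in> S \<Longrightarrow> f (Poly_Mapping.single x 1) \<in> U" "p \<in> coord_space S"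
  shows "f p \<in> U"
  by (rule lin_mem_subspace) (use assms in \<open>auto simp: coord_space_def\<close>)

lemma coord_space_subset_iff:
  assumes "pm.subspace U"
  shows "coord_space S \<subseteq> U \<longleftrightarrow> (\<forall>x\<in>S. Poly_Mapping.single x 1 \<in> U)"
  using lin_coord_space[OF lin_id(1) assms] by (auto simp: single_in_coord_space)

lemma push_coord_space: "p \<in> coord_space S \<Longrightarrow> push g p \<in> coord_space (g ` S)"
  using keys_push[of g p] by (fastforce simp: coord_space_def)

lemma tens_in_tensor: "u \<in> U \<Longrightarrow> w \<in> W \<Longrightarrow> tens u w \<in> tensor U W"
  unfolding tensor_def by (rule pm.span_base) blast

lemma tensor_subspace: "pm.subspace (tensor U W)"
  unfolding tensor_def by (rule pm.subspace_span)

lemma tensor_coord_space: "tensor (coord_space S) (coord_space T) = coord_space (S \<times> T)"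
proof
  show "tensor (coord_space S) (coord_space T) \<subseteq> coord_space (S \<times> T)"
    unfolding tensor_def
    by (rule pm.span_minimal[OF _ coord_space_subspace]) (auto simp: coord_space_def keys_tens)
  have "Poly_Mapping.single (x, y) 1 \<in> tensor (coord_space S) (coord_space T :: ('b \<Rightarrow>\<^sub>0 'c) set)"
    if "x \<in> S" "y \<in> T" for x y
  proof -
    have "Poly_Mapping.single (x, y) 1 = tens (Poly_Mapping.single x 1) (Poly_Mapping.single y (1::'c))"
      by (simp add: tens_single)
    then show ?thesis using that by (simp add: tens_in_tensor)
  qed
  then show "coord_space (S \<times> T) \<subseteq> tensor (coord_space S) (coord_space T :: ('b \<Rightarrow>\<^sub>0 'c) set)"
    by (subst coord_space_subset_iff) (auto simp: tensor_subspace)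
qed

lemma tens_psc_left: "tens (psc c u) w = psc c (tens u w)"
  and tens_psc_right: "tens u (psc c w) = psc c (tens u w)"
  by (auto intro!: poly_mapping_eqI)

lemma lin_tens: "lin (\<lambda>u. tens u w)" "lin (tens u)"
  by (auto simp: lin_on_def tens_add_left tens_add_right tens_psc_left tens_psc_right)

text \<open>A total substitute for \<open>tensor_map\<close>, given by a formula on basis vectors
  instead of a choice.\<close>

definition tmap ::
  "(('a \<Rightarrow>\<^sub>0 'k::field) \<Rightarrow> ('c \<Rightarrow>\<^sub>0 'k)) \<Rightarrow> (('b \<Rightarrow>\<^sub>0 'k) \<Rightarrow> ('d \<Rightarrow>\<^sub>0 'k)) \<Rightarrow>
   ('a \<times> 'b \<Rightarrow>\<^sub>0 'k) \<Rightarrow> ('c \<times> 'd \<Rightarrow>\<^sub>0 'k)" where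
  "tmap f g = lin_ext psc (\<lambda>(x, y). tens (f (Poly_Mapping.single x 1)) (g (Poly_Mapping.single y 1)))"

lemma lin_tmap: "lin (tmap f g)"
  unfolding tmap_def by (rule lin_lin_ext)

lemma tmap_single: "tmap f g (Poly_Mapping.single (x, y) 1) =
    tens (f (Poly_Mapping.single x 1)) (g (Poly_Mapping.single y 1))"
  by (simp add: tmap_def lin_ext_single)

lemma tmap_tens:
  assumes "lin f" "lin g"
  shows "tmap f g (tens u w) = tens (f u) (g w)"
proof (rule lin_eq_on_keys[where p = u])
  show "lin (\<lambda>u. tmap f g (tens u w))" by (rule lin_comp[OF lin_tmap lin_tens(1)])
  show "lin (\<lambda>u. tens (f u) (g w))" by (rule lin_comp[OF lin_tens(1) assms(1)])
  fix x
  show "tmap f g (tens (Poly_Mapping.single x 1) w) = tens (f (Poly_Mapping.single x 1)) (g w)"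
    by (rule lin_eq_on_keys[where p = w])
       (auto intro: lin_comp[OF lin_tmap lin_tens(2)] lin_comp[OF lin_tens(2) assms(2)]
             simp: tens_single tmap_single)
qed

text \<open>Both maps are linear on \<open>tensor U W\<close> and agree on pure tensors, so the
  uniqueness half of the universal property applies.\<close>

lemma tensor_map_eq_tmap:
  assumes "lin f" "lin g" "pm.subspace U" "pm.subspace W" "t \<in> tensor U W"
  shows "tensor_map U W f g t = tmap f g t"
proof -
  have "lin (\<lambda>u. tens (f u) (g w))" "lin (\<lambda>w. tens (f u) (g w))" for u w
    by (rule lin_comp[OF lin_tens(1) assms(1)], rule lin_comp[OF lin_tens(2) assms(2)])
  then have *: "lin_on psc U (\<lambda>u. tens (f u) (g w))" "lin_on psc W (\<lambda>w. tens (f u) (g w))" for u w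
    by (blast intro: lin_on_mono[OF _ subset_UNIV])+
  note ex = tensor_lift_exists[where U = U and W = W and \<beta> = "\<lambda>u w. tens (f u) (g w)",
      OF pm.vector_space_axioms assms(3,4) *]
  show ?thesis unfolding tensor_map_def
    by (rule tensor_lift_unique[OF pm.vector_space_axioms ex(1) _ _ assms(5)])
       (auto intro: lin_on_mono[OF lin_tmap subset_UNIV] simp: ex(2) tmap_tens assms)
qed

lemma tmap_tmap:
  assumes "lin f" "lin g"
  shows "tmap f g (tmap h k p) = tmap (\<lambda>x. f (h x)) (\<lambda>x. g (k x)) p"
  by (rule lin_eq_on_keys)
     (auto intro: lin_tmap lin_comp[OF lin_tmap lin_tmap] simp: tmap_single tmap_tens assms)

lemma tmap_push: "tmap (push g) (push h) p = push (map_prod g h) p"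
  by (rule lin_eq_on_keys[OF lin_tmap lin_push]) (auto simp: tmap_single push_single tens_single)

lemma tmap_eq_on_coord_space:
  assumes "\<And>x. x \<in> S \<Longrightarrow> f (Poly_Mapping.single x 1) = f' (Poly_Mapping.single x 1)"
    and "\<And>y. y \<in> T \<Longrightarrow> g (Poly_Mapping.single y 1) = g' (Poly_Mapping.single y 1)"
    and "p \<in> coord_space (S \<times> T)"
  shows "tmap f g p = tmap f' g' p"
  by (rule lin_eq_on_keys[OF lin_tmap lin_tmap])
     (use assms in \<open>auto simp: tmap_single coord_space_def subset_iff\<close>)

lemma tmap_in_tensor:
  assumes "\<And>x. x \<in> S \<Longrightarrow> f (Poly_Mapping.single x 1) \<in> U"
    and "\<And>y. y \<in> T \<Longrightarrow> g (Poly_Mapping.single y 1) \<in> W"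
    and "p \<in> coord_space (S \<times> T)"
  shows "tmap f g p \<in> tensor U W"
  by (rule lin_coord_space[OF lin_tmap _ _ assms(3)])
     (use assms(1,2) in \<open>auto simp: tmap_single tensor_subspace tens_in_tensor\<close>)

lemma tmap_id: "tmap id id p = p"
  by (rule lin_eq_on_keys[OF lin_tmap lin_id(1)]) (auto simp: tmap_single tens_single)

text \<open>Over a field both factors have linear left inverses, and the tensor product of these is
  a left inverse.\<close>

lemma inj_on_tmap:
  assumes "lin f" "lin g" "inj_on f (coord_space S)" "inj_on g (coord_space T)"
  shows "inj_on (tmap f g) (coord_space (S \<times> T))"
proof -
  obtain f' where f': "lin f'" "\<And>x. x \<in> coord_space S \<Longrightarrow> f' (f x) = x"
    using lin_left_inverse[OF assms(1) coord_space_subspace assms(3)] by blast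
  obtain g' where g': "lin g'" "\<And>x. x \<in> coord_space T \<Longrightarrow> g' (g x) = x"
    using lin_left_inverse[OF assms(2) coord_space_subspace assms(4)] by blast
  have "tmap f' g' (tmap f g p) = p" if "p \<in> coord_space (S \<times> T)" for p
  proof -
    have "tmap f' g' (tmap f g p) = tmap id id p"
      unfolding tmap_tmap[OF f'(1) g'(1)]
      by (rule tmap_eq_on_coord_space[OF _ _ that]) (auto simp: f'(2) g'(2))
    then show ?thesis by (simp add: tmap_id)
  qed
  then show ?thesis by (rule inj_on_inverseI)
qed


section \<open>Ring homomorphisms on monoid algebras\<close>

lemma psc_mult_left: "psc c p * q = psc c (p * q)"
  and psc_mult_right: "p * psc c q = psc c (p * q)"
  for p q :: "'a::comm_monoid_add \<Rightarrow>\<^sub>0 'k::field"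
  using psc_mult[of c p 1 q] psc_mult[of 1 p c q] by simp_all

lemma lin_mult: "lin (\<lambda>p. p * q)" "lin (\<lambda>p. q * p)"
  for q :: "'a::comm_monoid_add \<Rightarrow>\<^sub>0 'k::field"
  by (auto simp: lin_on_def distrib_left distrib_right psc_mult_left psc_mult_right)

text \<open>The restriction to the span of \<open>S\<close> matters: \<open>ipow\<close> gives no
  meaningful negative power of a non-unit, so evaluation maps are multiplicative only where the
  exponents are admissible.\<close>

definition mult_on :: "'a::comm_monoid_add set \<Rightarrow> (('a \<Rightarrow>\<^sub>0 'k::field) \<Rightarrow> ('b::comm_monoid_add \<Rightarrow>\<^sub>0 'k)) \<Rightarrow> bool" where
  "mult_on S f \<longleftrightarrow> (\<forall>p\<in>coord_space S. \<forall>q\<in>coord_space S. f (p * q) = f p * f q)"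

lemma mult_onD: "mult_on S f \<Longrightarrow> p \<in> coord_space S \<Longrightarrow> q \<in> coord_space S \<Longrightarrow> f (p * q) = f p * f q"
  by (auto simp: mult_on_def)

lemma mult_onI:
  fixes f :: "('a::comm_monoid_add \<Rightarrow>\<^sub>0 'k::field) \<Rightarrow> ('b::comm_monoid_add \<Rightarrow>\<^sub>0 'k)"
  assumes "lin f"
    and "\<And>x y. x \<in> S \<Longrightarrow> y \<in> S \<Longrightarrow>
      f (Poly_Mapping.single (x + y) 1) = f (Poly_Mapping.single x 1) * f (Poly_Mapping.single y 1)"
  shows "mult_on S f"
  unfolding mult_on_def
proof (intro ballI)
  fix p q :: "'a \<Rightarrow>\<^sub>0 'k" assume p: "p \<in> coord_space S" and q: "q \<in> coord_space S"
  show "f (p * q) = f p * f q"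
  proof (rule lin_eq_on_keys[where p = p])
    show "lin (\<lambda>p. f (p * q))" by (rule lin_comp[OF assms(1) lin_mult(1)])
    show "lin (\<lambda>p. f p * f q)" by (rule lin_comp[OF lin_mult(1) assms(1)])
    fix x assume "x \<in> Poly_Mapping.keys p"
    then have x: "x \<in> S" using p by (rule coord_spaceD[rotated])
    show "f (Poly_Mapping.single x 1 * q) = f (Poly_Mapping.single x 1) * f q"
    proof (rule lin_eq_on_keys[where p = q])
      show "lin (\<lambda>q. f (Poly_Mapping.single x 1 * q))" by (rule lin_comp[OF assms(1) lin_mult(2)])
      show "lin (\<lambda>q. f (Poly_Mapping.single x 1) * f q)" by (rule lin_comp[OF lin_mult(2) assms(1)])
      fix y assume "y \<in> Poly_Mapping.keys q"
      then show "f (Poly_Mapping.single x 1 * Poly_Mapping.single y 1) =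
          f (Poly_Mapping.single x 1) * f (Poly_Mapping.single y 1)"
        using assms(2)[OF x] q by (simp add: mult_single coord_spaceD)
    qed
  qed
qed

text \<open>The condition that makes \<open>coord_space S\<close> a unital subalgebra.\<close>

definition add_closed :: "'a::comm_monoid_add set \<Rightarrow> bool" where
  "add_closed S \<longleftrightarrow> 0 \<in> S \<and> (\<forall>x\<in>S. \<forall>y\<in>S. x + y \<in> S)"

lemma add_closed_Times: "add_closed S \<Longrightarrow> add_closed T \<Longrightarrow> add_closed (S \<times> T)"
  by (auto simp: add_closed_def zero_prod_def)

lemma coord_space_1: "add_closed S \<Longrightarrow> 1 \<in> coord_space S"
  by (simp add: add_closed_def flip: single_one)

lemma coord_space_mult: "p * q \<in> coord_space S" if "add_closed S" "p \<in> coord_space S" "q \<in> coord_space S"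
  for p q :: "'a::comm_monoid_add \<Rightarrow>\<^sub>0 'k::field"
  using that keys_mult[of p q] unfolding coord_space_def add_closed_def by blast

lemma coord_space_power: "p ^ n \<in> coord_space S" if "add_closed S" "p \<in> coord_space S"
  for p :: "'a::comm_monoid_add \<Rightarrow>\<^sub>0 'k::field"
  by (induction n) (auto intro: coord_space_1 coord_space_mult that)

lemma coord_space_prod: "(\<Prod>i\<in>I. f i) \<in> coord_space S" if "add_closed S" "\<And>i. i \<in> I \<Longrightarrow> f i \<in> coord_space S"
  for f :: "'i \<Rightarrow> 'a::comm_monoid_add \<Rightarrow>\<^sub>0 'k::field"
  using that(2)
  by (induction I rule: infinite_finite_induct) (auto intro: coord_space_1 coord_space_mult that(1))

lemma coord_space_sum: "(\<And>i. i \<in> I \<Longrightarrow> f i \<in> coord_space S) \<Longrightarrow> (\<Sum>i\<in>I. f i) \<in> coord_space S"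
  by (rule pm.subspace_sum[OF coord_space_subspace])

lemma mult_on_power:
  assumes "add_closed S" "mult_on S f" "f 1 = 1" "p \<in> coord_space S"
  shows "f (p ^ n) = f p ^ n"
  by (induction n) (auto simp: assms mult_onD[OF assms(2)] coord_space_power)

lemma mult_on_comp:
  assumes "mult_on S f" "mult_on T g" "\<And>p. p \<in> coord_space T \<Longrightarrow> g p \<in> coord_space S"
  shows "mult_on T (\<lambda>p. f (g p))"
  using assms by (auto simp: mult_on_def)

lemma mult_on_push:
  assumes "\<And>x y. g (x + y) = g x + g y"
  shows "mult_on S (push g)"
  by (rule mult_onI) (auto simp: lin_push push_single mult_single assms)

lemma push_mult:
  fixes p q :: "'a::comm_monoid_add \<Rightarrow>\<^sub>0 'k::field" and g :: "'a \<Rightarrow> 'b::comm_monoid_add"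
  shows "(\<And>x y. g (x + y) = g x + g y) \<Longrightarrow> push g (p * q) = push g p * push g q"
  by (rule mult_onD[OF mult_on_push[where S = UNIV]]) (auto simp: coord_space_def)

lemma push_1: "g 0 = 0 \<Longrightarrow> push g 1 = 1"
  by (simp add: push_single flip: single_one)

lemma mult_on_tmap:
  assumes "mult_on S f" "mult_on T g"
  shows "mult_on (S \<times> T) (tmap f g)"
proof (rule mult_onI[OF lin_tmap])
  fix x y assume "x \<in> S \<times> T" "y \<in> S \<times> T"
  then show "tmap f g (Poly_Mapping.single (x + y) 1) =
      tmap f g (Poly_Mapping.single x 1) * tmap f g (Poly_Mapping.single y 1)"
    using mult_onD[OF assms(1), of "Poly_Mapping.single (fst x) 1" "Poly_Mapping.single (fst y) 1"]
      mult_onD[OF assms(2), of "Poly_Mapping.single (snd x) 1" "Poly_Mapping.single (snd y) 1"]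
    by (auto simp: tmap_single tens_mult mult_single)
qed

lemma tens_1: "tens 1 1 = (1 :: 'a::comm_monoid_add \<times> 'b::comm_monoid_add \<Rightarrow>\<^sub>0 'k::field)"
  using tens_power[of 1 1 0] by simp

lemma tmap_1: "f 1 = 1 \<Longrightarrow> g 1 = 1 \<Longrightarrow> tmap f g 1 = 1"
  for f :: "('a::comm_monoid_add \<Rightarrow>\<^sub>0 'k::field) \<Rightarrow> ('b::comm_monoid_add \<Rightarrow>\<^sub>0 'k)"
    and g :: "('c::comm_monoid_add \<Rightarrow>\<^sub>0 'k) \<Rightarrow> ('d::comm_monoid_add \<Rightarrow>\<^sub>0 'k)"
  using tmap_single[of f g 0 0] by (simp add: tens_1 flip: zero_prod_def)

lemma tens_0 [simp]: "tens 0 p = 0" "tens p 0 = 0"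
  by (rule poly_mapping_eqI, auto)+

lemma mult_on_tens_left: "mult_on S (\<lambda>p. tens p 1)"
  and mult_on_tens_right: "mult_on S (tens 1)"
  by (auto simp: mult_on_def tens_mult)

section \<open>Additivity of the Frobenius in characteristic 2\<close>

lemma bit_poly_add_self [simp]: "p + p = 0" for p :: "'a \<Rightarrow>\<^sub>0 bit"
  by (rule poly_mapping_eqI) (simp add: lookup_add)

lemma power2_add_char2: "(p + q)^2 = p^2 + q^2" for p q :: "'a::comm_monoid_add \<Rightarrow>\<^sub>0 bit"
proof -
  have "(p + q)^2 = p^2 + q^2 + (p * q + p * q)"
    by (simp add: power2_eq_square algebra_simps del: bit_poly_add_self)
  then show ?thesis by simp
qed

lemma power2_sum_char2: "(\<Sum>i\<in>I. f i)^2 = (\<Sum>i\<in>I. (f i)^2)"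
  for f :: "'i \<Rightarrow> 'a::comm_monoid_add \<Rightarrow>\<^sub>0 bit"
  by (induction I rule: infinite_finite_induct) (auto simp: power2_add_char2)


section \<open>Homomorphisms out of the Laurent polynomial rings\<close>

definition B_exps :: "nat \<Rightarrow> (nat \<Rightarrow>\<^sub>0 int) set" where
  "B_exps n = {m. Poly_Mapping.keys m \<subseteq> {1..n} \<and> (\<forall>k<n. Poly_Mapping.lookup m k \<ge> 0)}"

definition Bplus_exps :: "nat \<Rightarrow> (nat \<Rightarrow>\<^sub>0 int) set" where
  "Bplus_exps n = {m. Poly_Mapping.keys m \<subseteq> {1..n} \<and> (\<forall>k. Poly_Mapping.lookup m k \<ge> 0)}"

lemma B_eq: "B n = coord_space (B_exps n)"
  and Bplus_eq: "Bplus n = coord_space (Bplus_exps n)"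
  by (auto simp: B_def Bplus_def coord_space_def B_exps_def Bplus_exps_def)

lemma Bplus_exps_subset_B_exps: "Bplus_exps n \<subseteq> B_exps n"
  by (auto simp: Bplus_exps_def B_exps_def)

lemma supp_outside: "Poly_Mapping.keys m \<subseteq> {1..n} \<Longrightarrow> k = 0 \<or> k > n \<Longrightarrow> Poly_Mapping.lookup m k = 0"
  for m :: "nat \<Rightarrow>\<^sub>0 int"
  using in_keys_iff[of k m] subsetD[of "Poly_Mapping.keys m" "{1..n}" k] by auto

lemma add_closed_B_exps: "add_closed (B_exps n)"
  using Poly_Mapping.keys_add unfolding add_closed_def B_exps_def
  by (fastforce simp: lookup_add)

lemma add_closed_Bplus_exps: "add_closed (Bplus_exps n)"
  using Poly_Mapping.keys_add unfolding add_closed_def Bplus_exps_def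
  by (fastforce simp: lookup_add)

lemma single_Bplus_exps: "k \<in> {1..n} \<Longrightarrow> a \<ge> 0 \<Longrightarrow> Poly_Mapping.single k a \<in> Bplus_exps n"
  by (auto simp: Bplus_exps_def lookup_single when_def)

lemma single_B_exps_top: "Poly_Mapping.single n a \<in> B_exps n \<or> n = 0"
  by (auto simp: B_exps_def lookup_single when_def)

lemma \<alpha>_Suc: "\<alpha> (Suc k) = Poly_Mapping.single (Poly_Mapping.single (Suc k) 1) 1"
  by (simp add: \<alpha>_def)

lemma \<alpha>_pos: "k > 0 \<Longrightarrow> \<alpha> k = Poly_Mapping.single (Poly_Mapping.single k 1) 1"
  by (simp add: \<alpha>_def)

lemma \<alpha>_Bplus: "k \<le> n \<Longrightarrow> \<alpha> k \<in> coord_space (Bplus_exps n)"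
  by (auto simp: \<alpha>_def coord_space_1 add_closed_Bplus_exps single_Bplus_exps)

text \<open>The evaluation homomorphism \<open>\<alpha> k \<mapsto> g k\<close>; the coproduct and
  its iteration are both instances.\<close>

definition ev :: "nat \<Rightarrow> (nat \<Rightarrow> ('a::comm_monoid_add \<Rightarrow>\<^sub>0 bit)) \<Rightarrow> laurent \<Rightarrow> ('a \<Rightarrow>\<^sub>0 bit)" where
  "ev n g = lin_ext psc (\<lambda>m. \<Prod>k\<in>{1..n}. ipow (g k) (Poly_Mapping.lookup m k))"

lemma \<Delta>_ev: "\<Delta> i j = ev (i + j) (\<Delta>_gen i j)"
  by (simp add: \<Delta>_def ev_def)

lemma lin_ev: "lin (ev n g)"
  unfolding ev_def by (rule lin_lin_ext)

lemma ev_single: "ev n g (Poly_Mapping.single m 1) = (\<Prod>k\<in>{1..n}. ipow (g k) (Poly_Mapping.lookup m k))"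
  by (simp add: ev_def lin_ext_single)

lemma ev_1: "ev n g 1 = 1"
  using ev_single[of n g 0] by (simp add: ipow_def)

lemma ev_\<alpha>:
  assumes "k \<in> {1..n}"
  shows "ev n g (\<alpha> k) = g k"
proof -
  have "ev n g (\<alpha> k) = (\<Prod>l\<in>{1..n}. ipow (g l) (Poly_Mapping.lookup (Poly_Mapping.single k 1) l))"
    using assms by (simp add: \<alpha>_pos ev_single)
  also have "\<dots> = (\<Prod>l\<in>{1..n}. if l = k then g k else 1)"
    by (intro prod.cong refl) (auto simp: lookup_single when_def ipow_def)
  finally have "ev n g (\<alpha> k) = (\<Prod>l\<in>{1..n}. if l = k then g k else 1)" .
  then show ?thesis using assms by simp
qed

text \<open>Only the last variable can carry a negative exponent in \<open>B_exps n\<close>, so a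
  unit is required at \<open>g n\<close> alone.\<close>

lemma mult_on_ev:
  assumes "g n * y = 1"
  shows "mult_on (B_exps n) (ev n g)"
proof (rule mult_onI[OF lin_ev])
  fix a b assume ab: "a \<in> B_exps n" "b \<in> B_exps n"
  have "ipow (g k) (Poly_Mapping.lookup (a + b) k) =
      ipow (g k) (Poly_Mapping.lookup a k) * ipow (g k) (Poly_Mapping.lookup b k)"
    if "k \<in> {1..n}" for k
    using ab that ipow_unit[OF assms] by (cases "k = n") (auto simp: B_exps_def lookup_add ipow_nonneg)
  then show "ev n g (Poly_Mapping.single (a + b) 1) =
      ev n g (Poly_Mapping.single a 1) * ev n g (Poly_Mapping.single b 1)"
    by (simp add: ev_single prod.distrib)
qed

lemma ev_coord_space_Bplus:
  assumes "add_closed S" "\<And>k. k \<in> {1..n} \<Longrightarrow> g k \<in> coord_space S" "p \<in> coord_space (Bplus_exps n)"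
  shows "ev n g p \<in> coord_space S"
  by (rule lin_coord_space[OF lin_ev coord_space_subspace _ assms(3)])
     (auto simp: ev_single Bplus_exps_def ipow_def intro!: coord_space_prod coord_space_power assms)

lemma ipow_inverse: "z * y = 1 \<Longrightarrow> ipow z e = (if e \<ge> 0 then z ^ nat e else y ^ nat (- e))"
proof -
  assume "z * y = 1"
  then have "(THE y. z * y = 1) = y"
    by (intro the_equality) (simp, metis mult.assoc mult.commute mult_1)
  then show ?thesis by (simp add: ipow_def)
qed

text \<open>Negative powers of \<open>g n\<close> are powers of \<open>y\<close>, so
  \<open>y\<close> has to lie in the subalgebra too.\<close>

lemma ev_coord_space_B:
  assumes "add_closed S" "\<And>k. k \<in> {1..n} \<Longrightarrow> g k \<in> coord_space S" "g n * y = 1" "y \<in> coord_space S" "p \<in> coord_space (B_exps n)"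
  shows "ev n g p \<in> coord_space S"
proof (rule lin_coord_space[OF lin_ev coord_space_subspace _ assms(5)])
  fix m assume m: "m \<in> B_exps n"
  have "ipow (g k) (Poly_Mapping.lookup m k) \<in> coord_space S" if "k \<in> {1..n}" for k
  proof (cases "k = n")
    case True
    then show ?thesis using that assms(1,2,4) by (simp add: ipow_inverse[OF assms(3)] coord_space_power)
  next
    case False
    then have "Poly_Mapping.lookup m k \<ge> 0" using that m by (auto simp: B_exps_def)
    then show ?thesis using that assms(1,2) by (simp add: ipow_def coord_space_power)
  qed
  then show "ev n g (Poly_Mapping.single m 1) \<in> coord_space S"
    unfolding ev_single by (intro coord_space_prod assms(1))
qed

text \<open>Induction on the total degree, splitting off one variable at a time.\<close>

lemma hom_eq_on_monomials:
  fixes f g :: "laurent \<Rightarrow> ('b::comm_monoid_add \<Rightarrow>\<^sub>0 bit)"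
  assumes "mult_on (B_exps n) f" "mult_on (B_exps n) g" "f 1 = 1" "g 1 = 1"
    and \<alpha>: "\<And>k. k \<in> {1..n} \<Longrightarrow> f (\<alpha> k) = g (\<alpha> k)" and m: "m \<in> Bplus_exps n"
  shows "f (Poly_Mapping.single m 1) = g (Poly_Mapping.single m 1)"
  using m
proof (induction "\<Sum>k\<in>{1..n}. nat (Poly_Mapping.lookup m k)" arbitrary: m rule: less_induct)
  case less
  show ?case
  proof (cases "m = 0")
    case True
    then show ?thesis by (simp add: assms(3,4))
  next
    case False
    then obtain k where k: "k \<in> Poly_Mapping.keys m" by (metis all_not_in_conv keys_eq_empty)
    with less.prems have kn: "k \<in> {1..n}" and pos: "Poly_Mapping.lookup m k > 0"
      by (auto simp: Bplus_exps_def in_keys_iff order_less_le subset_iff)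
    define m' where "m' = m - Poly_Mapping.single k 1"
    have m: "m = Poly_Mapping.single k 1 + m'" by (simp add: m'_def)
    have l: "Poly_Mapping.lookup m' l = Poly_Mapping.lookup m l - (if l = k then 1 else 0)" for l
      by (simp add: m'_def lookup_minus lookup_single when_def)
    have "Poly_Mapping.keys m' \<subseteq> Poly_Mapping.keys m"
      using k by (auto simp: in_keys_iff l split: if_splits)
    then have m': "m' \<in> Bplus_exps n" using less.prems pos by (auto simp: Bplus_exps_def l)
    have "f (Poly_Mapping.single m' 1) = g (Poly_Mapping.single m' 1)"
    proof (rule less.hyps[OF _ m'])
      show "(\<Sum>k = 1..n. nat (Poly_Mapping.lookup m' k)) < (\<Sum>k = 1..n. nat (Poly_Mapping.lookup m k))"
        by (rule sum_strict_mono_ex1) (use kn pos in \<open>auto simp: l intro!: bexI[of _ k]\<close>)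
    qed
    moreover have "Poly_Mapping.single m 1 = \<alpha> k * Poly_Mapping.single m' 1"
      using kn by (simp add: \<alpha>_pos mult_single m)
    moreover have "\<alpha> k \<in> coord_space (B_exps n)" "Poly_Mapping.single m' 1 \<in> coord_space (B_exps n)"
      using \<alpha>_Bplus[of k n] kn m' coord_space_mono[OF Bplus_exps_subset_B_exps[of n]] Bplus_exps_subset_B_exps[of n] by auto
    ultimately show ?thesis
      using \<alpha>[OF kn] by (simp add: mult_onD[OF assms(1)] mult_onD[OF assms(2)])
  qed
qed

text \<open>Multiplying by a power of \<open>\<alpha> n\<close> clears the only exponent that may be
  negative. The image of this power is a unit, as the power itself is one in \<open>B n\<close>, and
  can be cancelled again.\<close>

lemma hom_eq_on_B:
  fixes f g :: "laurent \<Rightarrow> ('b::comm_monoid_add \<Rightarrow>\<^sub>0 bit)"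
  assumes "lin f" "lin g" and f: "mult_on (B_exps n) f" and g: "mult_on (B_exps n) g"
    and 1: "f 1 = 1" "g 1 = 1"
    and \<alpha>: "\<And>k. k \<in> {1..n} \<Longrightarrow> f (\<alpha> k) = g (\<alpha> k)" and p: "p \<in> coord_space (B_exps n)"
  shows "f p = g p"
proof (rule lin_eq_on_keys[OF assms(1,2)])
  fix m assume "m \<in> Poly_Mapping.keys p"
  then have m: "m \<in> B_exps n" using p by (rule coord_spaceD[rotated])
  note eq = hom_eq_on_monomials[OF f g 1 \<alpha>]
  show "f (Poly_Mapping.single m 1) = g (Poly_Mapping.single m 1)"
  proof (cases "n = 0")
    case True
    then have "m \<in> Bplus_exps n" using m by (auto simp: Bplus_exps_def B_exps_def)
    then show ?thesis using eq by blast
  next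
    case False
    define N where "N = \<bar>Poly_Mapping.lookup m n\<bar>"
    let ?a = "Poly_Mapping.single (Poly_Mapping.single n N) 1 :: laurent"
    let ?b = "Poly_Mapping.single (Poly_Mapping.single n (- N)) 1 :: laurent"
    let ?m = "Poly_Mapping.single m 1 :: laurent"
    have "Poly_Mapping.single n N \<in> Bplus_exps n" using False by (intro single_Bplus_exps) (auto simp: N_def)
    moreover have "m + Poly_Mapping.single n N \<in> Bplus_exps n"
    proof -
      have "Poly_Mapping.lookup (m + Poly_Mapping.single n N) k \<ge> 0" for k
        using m supp_outside[of m n k]
        by (cases k n rule: linorder_cases) (auto simp: B_exps_def N_def lookup_add lookup_single when_def)
      moreover have "m + Poly_Mapping.single n N \<in> B_exps n"
        using m single_B_exps_top[of n N] False add_closed_B_exps[of n] by (auto simp: add_closed_def)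
      ultimately show ?thesis by (auto simp: Bplus_exps_def B_exps_def)
    qed
    ultimately have e: "f ?a = g ?a" "f (?m * ?a) = g (?m * ?a)"
      using eq by (auto simp: mult_single)
    have in_B: "?a \<in> coord_space (B_exps n)" "?b \<in> coord_space (B_exps n)" "?m \<in> coord_space (B_exps n)"
      using single_B_exps_top[of n] False m by auto
    have "?a * ?b = 1" by (simp add: mult_single flip: single_add)
    then have u: "f ?a * f ?b = 1" using mult_onD[OF f in_B(1,2)] 1(1) by simp
    have "f ?m * f ?a = g ?m * f ?a"
      using e in_B by (simp add: mult_onD[OF f] mult_onD[OF g])
    then have "f ?m * (f ?a * f ?b) = g ?m * (f ?a * f ?b)"
      by (simp only: mult.assoc[symmetric])
    then show ?thesis by (simp add: u)
  qed
qed


section \<open>The coproduct\<close>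

lemma lin_\<Delta>: "lin (\<Delta> i j)"
  unfolding \<Delta>_ev by (rule lin_ev)

lemma mult_on_\<Delta>: "mult_on (B_exps (i + j)) (\<Delta> i j)"
  unfolding mult_on_def by (simp add: \<Delta>_mult flip: B_eq)

lemma \<Delta>_gen_coord_space: "\<Delta>_gen i j k \<in> coord_space (Bplus_exps i \<times> Bplus_exps j)"
proof -
  have "tens (\<alpha> s ^ 2 ^ t) (\<alpha> t) \<in> coord_space (Bplus_exps i \<times> Bplus_exps j)" if "s \<le> i" "t \<le> j" for s t
    using tens_in_tensor[OF coord_space_power[OF add_closed_Bplus_exps \<alpha>_Bplus[OF that(1)]] \<alpha>_Bplus[OF that(2)]]
    by (simp add: tensor_coord_space)
  then show ?thesis unfolding \<Delta>_gen_def by (auto intro!: coord_space_sum)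
qed

lemma \<Delta>_coord_space_Bplus: "p \<in> coord_space (Bplus_exps (i + j)) \<Longrightarrow> \<Delta> i j p \<in> coord_space (Bplus_exps i \<times> Bplus_exps j)"
  unfolding \<Delta>_ev
  by (rule ev_coord_space_Bplus) (auto intro: add_closed_Times add_closed_Bplus_exps \<Delta>_gen_coord_space)

lemma \<alpha>_inverse: "\<exists>y\<in>coord_space (B_exps k). \<alpha> k * y = 1"
proof (cases "k = 0")
  case True
  then show ?thesis by (auto simp: \<alpha>_def intro!: bexI[of _ 1] coord_space_1 add_closed_B_exps)
next
  case False
  then show ?thesis using single_B_exps_top[of k "- 1"]
    by (intro bexI[of _ "Poly_Mapping.single (Poly_Mapping.single k (- 1)) 1"])
       (auto simp: \<alpha>_pos mult_single simp flip: single_add)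
qed

lemma \<Delta>_coord_space_B:
  assumes "p \<in> coord_space (B_exps (i + j))"
  shows "\<Delta> i j p \<in> coord_space (B_exps i \<times> B_exps j)"
proof -
  obtain y z where y: "y \<in> coord_space (B_exps i)" "\<alpha> i * y = 1" and z: "z \<in> coord_space (B_exps j)" "\<alpha> j * z = 1"
    using \<alpha>_inverse by meson
  show ?thesis unfolding \<Delta>_ev
  proof (rule ev_coord_space_B[OF _ _ _ _ assms])
    show "add_closed (B_exps i \<times> B_exps j)" by (intro add_closed_Times add_closed_B_exps)
    show "\<Delta>_gen i j k \<in> coord_space (B_exps i \<times> B_exps j)" for k
      using \<Delta>_gen_coord_space coord_space_mono[OF Sigma_mono[OF Bplus_exps_subset_B_exps[of i] Bplus_exps_subset_B_exps[of j]]] by blast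
    show "\<Delta>_gen i j (i + j) * tens (y ^ 2 ^ j) z = 1"
      by (simp add: \<Delta>_gen_top tens_mult y z tens_1 flip: power_mult_distrib)
    show "tens (y ^ 2 ^ j) z \<in> coord_space (B_exps i \<times> B_exps j)"
      using y z by (auto intro!: tens_in_tensor coord_space_power add_closed_B_exps simp flip: tensor_coord_space)
  qed
qed

text \<open>For \<open>i = 0\<close> only the term \<open>s = 0\<close> survives on generators; the
  rest is comparison of homomorphisms.\<close>

lemma \<Delta>_0_left: "p \<in> coord_space (B_exps n) \<Longrightarrow> \<Delta> 0 n p = tens 1 p"
proof (rule hom_eq_on_B[of "\<Delta> 0 n" "tens 1" n])
  fix k assume "k \<in> {1..n}"
  then have "{(s, t). s + t = k \<and> s \<le> (0::nat) \<and> t \<le> n} = {(0, k)}" by auto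
  then show "\<Delta> 0 n (\<alpha> k) = tens 1 (\<alpha> k)"
    using \<open>k \<in> {1..n}\<close> by (simp add: \<Delta>_\<alpha> \<Delta>_gen_def) (simp add: \<alpha>_def)
qed (use mult_on_\<Delta>[of 0 n] in \<open>auto simp: lin_\<Delta> lin_tens \<Delta>_1 tens_1 mult_on_tens_right\<close>)

lemma \<Delta>_0_right: "p \<in> coord_space (B_exps n) \<Longrightarrow> \<Delta> n 0 p = tens p 1"
proof (rule hom_eq_on_B[of "\<Delta> n 0" "\<lambda>p. tens p 1" n])
  fix k assume "k \<in> {1..n}"
  then have "{(s, t). s + t = k \<and> s \<le> n \<and> t \<le> (0::nat)} = {(k, 0)}" by auto
  then show "\<Delta> n 0 (\<alpha> k) = tens (\<alpha> k) 1"
    using \<open>k \<in> {1..n}\<close> by (simp add: \<Delta>_\<alpha> \<Delta>_gen_def) (simp add: \<alpha>_def)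
qed (use mult_on_\<Delta>[of n 0] in \<open>auto simp: lin_\<Delta> lin_tens \<Delta>_1 tens_1 mult_on_tens_left\<close>)


section \<open>The iterated coproduct\<close>

text \<open>\<open>iter_\<alpha> n k\<close> is the image of \<open>\<alpha> k\<close> under the iterated coproduct \<open>B n \<rightarrow> (B 1)\<^bsup>\<otimes>n\<^esup>\<close>, the target
  being read as a subring of \<^typ>\<open>laurent\<close> with one variable \<open>\<alpha> i\<close> per tensor factor: it is the
  coefficient of \<open>\<tau>\<^bsup>k\<^esup>\<close> in \<open>(1 + \<alpha> n \<tau>) \<dots> (1 + \<alpha> 1 \<tau>)\<close>, where \<open>\<tau>\<close> is the Frobenius.\<close>

primrec iter_\<alpha> :: "nat \<Rightarrow> nat \<Rightarrow> laurent" where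
  "iter_\<alpha> 0 k = (if k = 0 then 1 else 0)"
| "iter_\<alpha> (Suc n) k = iter_\<alpha> n k + (case k of 0 \<Rightarrow> 0 | Suc l \<Rightarrow> \<alpha> (Suc n) * iter_\<alpha> n l ^ 2)"

lemma iter_\<alpha>_0: "iter_\<alpha> n 0 = 1"
  by (induction n) auto

lemma iter_\<alpha>_gt: "k > n \<Longrightarrow> iter_\<alpha> n k = 0"
  by (induction n arbitrary: k) (auto split: nat.split)

lemma Bplus_exps_mono: "m \<le> n \<Longrightarrow> Bplus_exps m \<subseteq> Bplus_exps n"
  by (auto simp: Bplus_exps_def)

lemma iter_\<alpha>_coord_space: "iter_\<alpha> n k \<in> coord_space (Bplus_exps n)"
proof (induction n arbitrary: k)
  case (Suc n)
  have "iter_\<alpha> n k \<in> coord_space (Bplus_exps (Suc n))" for k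
    using Suc.IH coord_space_mono[OF Bplus_exps_mono[of n "Suc n"]] by auto
  then show ?case
    by (auto intro!: pm.subspace_add[OF coord_space_subspace] coord_space_mult coord_space_power add_closed_Bplus_exps \<alpha>_Bplus
        split: nat.split simp: pm.subspace_0[OF coord_space_subspace])
qed (auto simp: coord_space_1 add_closed_Bplus_exps pm.subspace_0[OF coord_space_subspace])

text \<open>Exponent of the monomial \<open>\<alpha> n * \<alpha> (n - 1) ^ 2 * \<alpha> (n - 2) ^ 4
  * ...\<close>; the doubling mirrors the square in the recursion of
  \<open>iter_\<alpha>\<close>.\<close>

primrec cvec :: "nat \<Rightarrow> (nat \<Rightarrow>\<^sub>0 int)" where
  "cvec 0 = 0"
| "cvec (Suc n) = Poly_Mapping.single (Suc n) 1 + (cvec n + cvec n)"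

lemma lookup_cvec: "Poly_Mapping.lookup (cvec n) k = (if k \<in> {1..n} then 2 ^ (n - k) else 0)"
proof (induction n)
  case (Suc n)
  then show ?case
    by (simp only: cvec.simps lookup_add)
       (auto simp: lookup_single when_def Suc_diff_le le_Suc_eq)
qed simp

text \<open>In top degree the first summand of the recursion vanishes, so no sum ever arises. This
  makes the image of \<open>\<alpha> n\<close> invertible.\<close>

lemma iter_\<alpha>_top: "iter_\<alpha> n n = Poly_Mapping.single (cvec n) 1"
  by (induction n) (auto simp: iter_\<alpha>_gt \<alpha>_Suc mult_single power2_eq_square)

lemma iter_\<alpha>_top_inverse: "iter_\<alpha> n n * Poly_Mapping.single (- cvec n) 1 = 1"
  by (simp add: iter_\<alpha>_top mult_single)

definition \<Phi> :: "nat \<Rightarrow> laurent \<Rightarrow> laurent" where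
  "\<Phi> n = ev n (iter_\<alpha> n)"

lemma lin_\<Phi>: "lin (\<Phi> n)"
  unfolding \<Phi>_def by (rule lin_ev)

lemma \<Phi>_1: "\<Phi> n 1 = 1"
  by (simp add: \<Phi>_def ev_1)

lemma \<Phi>_\<alpha>: "k \<le> n \<Longrightarrow> \<Phi> n (\<alpha> k) = iter_\<alpha> n k"
  by (cases "k = 0") (auto simp: \<Phi>_def ev_\<alpha> iter_\<alpha>_0, simp add: \<alpha>_def ev_1)

lemma mult_on_\<Phi>: "mult_on (B_exps n) (\<Phi> n)"
  unfolding \<Phi>_def by (rule mult_on_ev[OF iter_\<alpha>_top_inverse])

text \<open>Identifies the ring in all variables with the tensor product of the ring in the
  variables up to \<open>i\<close> and the ring in the later ones, renumbered from 1. The filter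
  \<open>k > i\<close> is there because the shift would otherwise move variable \<open>i\<close> to
  index 0.\<close>

definition split_vars :: "nat \<Rightarrow> (nat \<Rightarrow>\<^sub>0 int) \<Rightarrow> (nat \<Rightarrow>\<^sub>0 int) \<times> (nat \<Rightarrow>\<^sub>0 int)" where
  "split_vars i m =
     (Poly_Mapping.mapp (\<lambda>k v. v when k \<le> i) m,
      Poly_Mapping.map_key (\<lambda>k. k + i) (Poly_Mapping.mapp (\<lambda>k v. v when k > i) m))"

lemma lookup_split_vars:
  "Poly_Mapping.lookup (fst (split_vars i m)) k = (if k \<le> i then Poly_Mapping.lookup m k else 0)"
  "Poly_Mapping.lookup (snd (split_vars i m)) k = (if k > 0 then Poly_Mapping.lookup m (k + i) else 0)"
  by (auto simp: split_vars_def lookup_mapp when_def in_keys_iff map_key.rep_eq inj_def)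

lemma split_vars_add: "split_vars i (x + y) = split_vars i x + split_vars i y"
  by (auto intro!: prod_eqI poly_mapping_eqI simp: lookup_split_vars lookup_add)

lemma split_vars_0: "split_vars i 0 = 0"
  using split_vars_add[of i 0 0] by simp

lemma split_vars_left: "Poly_Mapping.keys m \<subseteq> {1..i} \<Longrightarrow> split_vars i m = (m, 0)"
  by (auto intro!: prod_eqI poly_mapping_eqI simp: lookup_split_vars supp_outside)

lemma split_vars_right: "j > 0 \<Longrightarrow> split_vars i (Poly_Mapping.single (i + j) a) = (0, Poly_Mapping.single j a)"
  by (auto intro!: prod_eqI poly_mapping_eqI simp: lookup_split_vars lookup_single when_def)

lemma push_split_vars_left:
  assumes "p \<in> coord_space (Bplus_exps i)"
  shows "push (split_vars i) p = tens p 1"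
proof (rule lin_eq_on_keys[OF lin_push lin_tens(1)])
  fix m assume "m \<in> Poly_Mapping.keys p"
  then have "Poly_Mapping.keys m \<subseteq> {1..i}" using assms by (auto simp: coord_space_def Bplus_exps_def)
  then show "push (split_vars i) (Poly_Mapping.single m 1) = tens (Poly_Mapping.single m 1) 1"
    by (simp add: push_single split_vars_left tens_single flip: single_one)
qed

text \<open>The twisted polynomial with coefficients \<open>iter_\<alpha> (i + j)\<close> is the
  product of the one in the last \<open>j\<close> variables and the one in the first
  \<open>i\<close>; moving the \<open>t\<close>-th power of the Frobenius past a coefficient raises
  it to the power \<open>2 ^ t\<close>. The induction on \<open>j\<close> peels off the leftmost
  factor.\<close>

lemma split_iter_\<alpha>: "push (split_vars i) (iter_\<alpha> (i + j) k) = (\<Sum>t\<le>k. tens (iter_\<alpha> i (k - t) ^ 2 ^ t) (iter_\<alpha> j t))"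
proof (induction j arbitrary: k)
  case 0
  have "(\<Sum>t\<le>k. tens (iter_\<alpha> i (k - t) ^ 2 ^ t) (iter_\<alpha> 0 t)) = (\<Sum>t\<le>k. if t = 0 then tens (iter_\<alpha> i k) 1 else 0)"
    by (intro sum.cong refl) (auto intro!: poly_mapping_eqI)
  then show ?case by (simp add: push_split_vars_left[OF iter_\<alpha>_coord_space] del: iter_\<alpha>.simps)
next
  case (Suc j)
  note m = push_mult[of "split_vars i", OF split_vars_add]
  show ?case
  proof (cases k)
    case 0
    then show ?thesis using Suc.IH[of 0] by (simp add: iter_\<alpha>_0)
  next
    case (Suc l)
    have x: "push (split_vars i) (\<alpha> (Suc (i + j))) = tens 1 (\<alpha> (Suc j))"
      using split_vars_right[of "Suc j" i 1]
      by (simp add: \<alpha>_Suc push_single tens_single flip: single_one)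
    have "push (split_vars i) (iter_\<alpha> (i + Suc j) k) =
        push (split_vars i) (iter_\<alpha> (i + j) k) + tens 1 (\<alpha> (Suc j)) * push (split_vars i) (iter_\<alpha> (i + j) l) ^ 2"
      by (simp add: Suc lin_add[OF lin_push] m x power2_eq_square)
    \<comment> \<open>Squaring is termwise. It turns the twist \<open>2 ^ t\<close> into
      \<open>2 ^ Suc t\<close> and produces in the second factor the new term of the recursion for
      \<open>iter_\<alpha> (Suc j)\<close>.\<close>
    also have "tens 1 (\<alpha> (Suc j)) * push (split_vars i) (iter_\<alpha> (i + j) l) ^ 2 =
        (\<Sum>t\<le>l. tens (iter_\<alpha> i (l - t) ^ 2 ^ Suc t) (\<alpha> (Suc j) * iter_\<alpha> j t ^ 2))"
      by (simp add: Suc.IH power2_sum_char2 sum_distrib_left tens_power tens_mult mult.commute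
          flip: power_mult)
    also have "push (split_vars i) (iter_\<alpha> (i + j) k) = (\<Sum>t\<le>k. tens (iter_\<alpha> i (k - t) ^ 2 ^ t) (iter_\<alpha> j t))"
      by (rule Suc.IH)
    finally show ?thesis
      by (simp add: Suc sum.atMost_Suc_shift tens_add_right sum.distrib ac_simps del: sum.atMost_Suc)
  qed
qed

text \<open>Under the embedding the coproduct becomes the mere splitting of the variables into two
  blocks. Both sides are homomorphisms on \<open>B (i + j)\<close>, and on generators the claim is
  \<open>split_iter_\<alpha>\<close>.\<close>

lemma \<Phi>_\<Delta>:
  assumes "p \<in> coord_space (B_exps (i + j))"
  shows "tmap (\<Phi> i) (\<Phi> j) (\<Delta> i j p) = push (split_vars i) (\<Phi> (i + j) p)"
proof (rule hom_eq_on_B[OF _ _ _ _ _ _ _ assms])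
  show "lin (\<lambda>p. tmap (\<Phi> i) (\<Phi> j) (\<Delta> i j p))" by (rule lin_comp[OF lin_tmap lin_\<Delta>])
  show "lin (\<lambda>p. push (split_vars i) (\<Phi> (i + j) p))" by (rule lin_comp[OF lin_push lin_\<Phi>])
  show "mult_on (B_exps (i + j)) (\<lambda>p. tmap (\<Phi> i) (\<Phi> j) (\<Delta> i j p))"
    by (rule mult_on_comp[OF mult_on_tmap[OF mult_on_\<Phi> mult_on_\<Phi>] mult_on_\<Delta> \<Delta>_coord_space_B])
  show "mult_on (B_exps (i + j)) (\<lambda>p. push (split_vars i) (\<Phi> (i + j) p))"
    by (rule mult_on_comp[OF mult_on_push[of _ UNIV] mult_on_\<Phi>]) (auto simp: split_vars_add coord_space_def)
  show "tmap (\<Phi> i) (\<Phi> j) (\<Delta> i j 1) = 1" by (simp add: \<Delta>_1 tmap_1 \<Phi>_1)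
  show "push (split_vars i) (\<Phi> (i + j) 1) = 1" by (simp add: \<Phi>_1 push_1 split_vars_0)
  fix k assume k: "k \<in> {1..i + j}"
  let ?S = "{(s, t). s + t = k \<and> s \<le> i \<and> t \<le> j}"
  have "\<Phi> i (\<alpha> s ^ N) = iter_\<alpha> i s ^ N" if "s \<le> i" for s N
    using mult_on_power[OF add_closed_B_exps mult_on_\<Phi> \<Phi>_1, of "\<alpha> s" i N] \<alpha>_Bplus[OF that]
      coord_space_mono[OF Bplus_exps_subset_B_exps[of i]] by (auto simp: \<Phi>_\<alpha> that)
  then have "tmap (\<Phi> i) (\<Phi> j) (\<Delta> i j (\<alpha> k)) = (\<Sum>(s, t)\<in>?S. tens (iter_\<alpha> i s ^ 2 ^ t) (iter_\<alpha> j t))"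
    using k
    by (auto simp: \<Delta>_\<alpha> \<Delta>_gen_def lin_sum[OF lin_tmap] tmap_tens lin_\<Phi> \<Phi>_\<alpha> intro!: sum.cong)
  also have "\<dots> = (\<Sum>(s, t)\<in>{(s, t). s + t = k}. tens (iter_\<alpha> i s ^ 2 ^ t) (iter_\<alpha> j t))"
  proof (rule sum.mono_neutral_left)
    have "{(s, t). s + t = k} \<subseteq> {..k} \<times> {..k}" by auto
    then show "finite {(s, t). s + t = k}" by (rule finite_subset) auto
    show "\<forall>x\<in>{(s, t). s + t = k} - ?S. (case x of (s, t) \<Rightarrow> tens (iter_\<alpha> i s ^ 2 ^ t) (iter_\<alpha> j t)) = 0"
    proof
      fix x assume "x \<in> {(s, t). s + t = k} - ?S"
      then obtain s t where x: "x = (s, t)" "\<not> (s \<le> i \<and> t \<le> j)" by auto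
      then have "iter_\<alpha> i s ^ 2 ^ t = 0 \<or> iter_\<alpha> j t = 0"
        by (auto simp: iter_\<alpha>_gt not_le zero_power)
      then show "(case x of (s, t) \<Rightarrow> tens (iter_\<alpha> i s ^ 2 ^ t) (iter_\<alpha> j t)) = 0" by (auto simp: x(1) zero_power)
    qed
  qed auto
  also have "\<dots> = (\<Sum>t\<le>k. tens (iter_\<alpha> i (k - t) ^ 2 ^ t) (iter_\<alpha> j t))"
    by (rule sum.reindex_bij_witness[of _ "\<lambda>t. (k - t, t)" snd]) auto
  finally show "tmap (\<Phi> i) (\<Phi> j) (\<Delta> i j (\<alpha> k)) = push (split_vars i) (\<Phi> (i + j) (\<alpha> k))"
    using k by (simp add: \<Phi>_\<alpha> split_iter_\<alpha>)
qed


section \<open>Leading monomials\<close>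

text \<open>The order on exponents is lexicographic, the variable of smallest index being the most
  significant one.\<close>

definition lead :: "('a::linorder \<Rightarrow>\<^sub>0 bit) \<Rightarrow> 'a \<Rightarrow> bool" where
  "lead p m \<longleftrightarrow> m \<in> Poly_Mapping.keys p \<and> (\<forall>m'\<in>Poly_Mapping.keys p. m' \<le> m)"

text \<open>A nonzero coefficient in \<bbbF>2 is 1, so a leading term can be split off without
  scaling.\<close>

lemma lead_iff: "lead p m \<longleftrightarrow> (\<exists>q\<in>coord_space {..<m}. p = Poly_Mapping.single m 1 + q)"
proof
  assume l: "lead p m"
  define q where "q = p - Poly_Mapping.single m 1"
  have "q \<in> coord_space {..<m}"
  proof -
    have "x < m" if "x \<in> Poly_Mapping.keys q" for x
    proof -
      have "Poly_Mapping.lookup p m = 1" using l by (simp add: lead_def in_keys_iff)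
      then have "x \<noteq> m" using that by (auto simp: q_def in_keys_iff lookup_minus)
      then have "x \<in> Poly_Mapping.keys p"
        using that by (auto simp: q_def in_keys_iff lookup_minus lookup_single)
      then show ?thesis using l \<open>x \<noteq> m\<close> by (auto simp: lead_def order_less_le)
    qed
    then show ?thesis by (auto simp: coord_space_def)
  qed
  then show "\<exists>q\<in>coord_space {..<m}. p = Poly_Mapping.single m 1 + q" by (intro bexI[of _ q]) (auto simp: q_def)
next
  assume "\<exists>q\<in>coord_space {..<m}. p = Poly_Mapping.single m 1 + q"
  then obtain q where q: "q \<in> coord_space {..<m}" "p = Poly_Mapping.single m 1 + q" by auto
  have "m \<notin> Poly_Mapping.keys q" using q(1) by (auto simp: coord_space_def)
  then have "m \<in> Poly_Mapping.keys p" by (auto simp: in_keys_iff q(2) lookup_add)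
  moreover have "x \<le> m" if "x \<in> Poly_Mapping.keys p" for x
    using that q(1) Poly_Mapping.keys_add[of "Poly_Mapping.single m 1" q]
    by (auto simp: q(2) coord_space_def split: if_splits)
  ultimately show "lead p m" by (auto simp: lead_def)
qed

lemma lead_exists: "p \<noteq> 0 \<Longrightarrow> \<exists>m. lead p m"
  unfolding lead_def by (rule exI[of _ "Max (Poly_Mapping.keys p)"]) simp

lemma lead_single: "lead (Poly_Mapping.single m 1) m"
  by (simp add: lead_def)

lemma lead_add:
  assumes "lead p m" "q \<in> coord_space {..<m}"
  shows "lead (p + q) m"
proof -
  obtain r where "r \<in> coord_space {..<m}" "p = Poly_Mapping.single m 1 + r" using assms(1) by (auto simp: lead_iff)
  with assms(2) show ?thesis
    by (auto simp: lead_iff add.assoc intro!: bexI[of _ "r + q"] pm.subspace_add[OF coord_space_subspace])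
qed

lemma lead_less_coord_space: "lead p m \<Longrightarrow> m < m' \<Longrightarrow> p \<in> coord_space {..<m'}"
  by (auto simp: lead_def coord_space_def)

text \<open>Addition of exponents is strictly monotone, so the product of the leading monomials
  exceeds every other product and cannot be cancelled.\<close>

lemma lead_mult:
  fixes p q :: "'a::linordered_ab_group_add \<Rightarrow>\<^sub>0 bit"
  assumes "lead p a" "lead q b"
  shows "lead (p * q) (a + b)"
proof -
  obtain p' where p: "p' \<in> coord_space {..<a}" "p = Poly_Mapping.single a 1 + p'"
    using assms(1) by (auto simp: lead_iff)
  obtain q' where q: "q' \<in> coord_space {..<b}" "q = Poly_Mapping.single b 1 + q'"
    using assms(2) by (auto simp: lead_iff)
  have "p * q = Poly_Mapping.single a 1 * (Poly_Mapping.single b 1 + q') + p' * q"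
    by (simp only: p(2) distrib_right flip: q(2))
  also have "\<dots> = Poly_Mapping.single (a + b) 1 + (Poly_Mapping.single a 1 * q' + p' * q)"
    by (simp add: distrib_left mult_single add.assoc)
  finally have "p * q = Poly_Mapping.single (a + b) 1 + (Poly_Mapping.single a 1 * q' + p' * q)" .
  moreover have "Poly_Mapping.single a 1 * q' \<in> coord_space {..<a + b}"
    using keys_mult[of "Poly_Mapping.single a 1" q'] q(1) by (fastforce simp: coord_space_def)
  moreover have "p' * q \<in> coord_space {..<a + b}"
    using keys_mult[of p' q] p(1) assms(2)
    by (force simp: coord_space_def lead_def intro: add_less_le_mono)
  ultimately show ?thesis
    by (auto simp: lead_iff intro: pm.subspace_add[OF coord_space_subspace])
qed

lemma lead_1: "lead 1 (0 :: 'a::linordered_ab_group_add)"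
  using lead_single[of 0] by simp

lemma lead_prod:
  fixes f :: "'i \<Rightarrow> ('a::linordered_ab_group_add \<Rightarrow>\<^sub>0 bit)"
  shows "(\<And>i. i \<in> I \<Longrightarrow> lead (f i) (m i)) \<Longrightarrow> lead (\<Prod>i\<in>I. f i) (\<Sum>i\<in>I. m i)"
  by (induction I rule: infinite_finite_induct) (auto intro: lead_1 lead_mult)

lemma lead_power:
  fixes p :: "(nat \<Rightarrow>\<^sub>0 int) \<Rightarrow>\<^sub>0 bit"
  assumes "lead p m"
  shows "lead (p ^ n) (psc (int n) m)"
proof (induction n)
  case 0
  have "psc 0 m = 0" by (rule poly_mapping_eqI) simp
  then show ?case by (simp add: lead_1)
next
  case (Suc n)
  have "psc (int (Suc n)) m = m + psc (int n) m"
    by (rule poly_mapping_eqI) (simp add: lookup_add algebra_simps)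
  then show ?case using lead_mult[OF assms Suc] by simp
qed

section \<open>Leading exponents of the iterated coproduct\<close>

lemma single_less_single: "i < j \<Longrightarrow> Poly_Mapping.single j (1::int) < Poly_Mapping.single (i::nat) 1"
  unfolding less_poly_mapping.rep_eq
  by (intro less_funI exI[of _ i]) (auto simp: lookup_single when_def)

text \<open>The largest monomial uses the \<open>k\<close> most significant variables, so it is
  already that of \<open>iter_\<alpha> k k\<close> and later variables contribute only smaller
  terms.\<close>

lemma lead_iter_\<alpha>: "k \<le> n \<Longrightarrow> lead (iter_\<alpha> n k) (cvec k)"
proof (induction n arbitrary: k)
  case 0
  then show ?case by (simp add: lead_1)
next
  case (Suc n)
  show ?case
  proof (cases k)
    case 0
    then show ?thesis by (simp only: iter_\<alpha>_0 cvec.simps lead_1)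
  next
    case k: (Suc l)
    show ?thesis
    proof (cases "k \<le> n")
      case True
      have "lead (\<alpha> (Suc n) * iter_\<alpha> n l ^ 2) (Poly_Mapping.single (Suc n) 1 + (cvec l + cvec l))"
        unfolding power2_eq_square \<alpha>_Suc
        using True k by (intro lead_mult lead_single Suc.IH) auto
      \<comment> \<open>Both sides contain the same doubled part; they differ in having variable
        \<open>Suc n\<close> or the more significant variable \<open>k\<close>.\<close>
      moreover have "Poly_Mapping.single (Suc n) 1 + (cvec l + cvec l) < cvec k"
        using True k by (auto simp: single_less_single)
      ultimately have "\<alpha> (Suc n) * iter_\<alpha> n l ^ 2 \<in> coord_space {..<cvec k}" by (rule lead_less_coord_space)
      with Suc.IH[OF True] show ?thesis by (simp add: k lead_add del: cvec.simps)
    next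
      case False
      with Suc.prems have "k = Suc n" by simp
      then show ?thesis by (simp only: iter_\<alpha>_top lead_single)
    qed
  qed
qed

text \<open>Leading exponents add under multiplication, so the image of the monomial with exponent
  \<open>m\<close> has a leading exponent that is linear in \<open>m\<close>.\<close>

definition \<Lambda> :: "nat \<Rightarrow> (nat \<Rightarrow>\<^sub>0 int) \<Rightarrow> (nat \<Rightarrow>\<^sub>0 int)" where
  "\<Lambda> n m = (\<Sum>k\<in>{1..n}. psc (Poly_Mapping.lookup m k) (cvec k))"

lemma lookup_\<Lambda>_outside: "i = 0 \<or> i > n \<Longrightarrow> Poly_Mapping.lookup (\<Lambda> n m) i = 0"
  by (auto simp: \<Lambda>_def lookup_sum lookup_cvec intro!: sum.neutral)

text \<open>Entry \<open>i\<close> of \<open>cvec k\<close> is twice entry \<open>Suc i\<close>,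
  except for the diagonal entry 1 at \<open>k = i\<close>. This triangular recursion recovers
  \<open>m\<close> from its leading exponent.\<close>

lemma lookup_\<Lambda>_step:
  assumes "i \<in> {1..n}"
  shows "Poly_Mapping.lookup (\<Lambda> n m) i =
    Poly_Mapping.lookup m i + 2 * Poly_Mapping.lookup (\<Lambda> n m) (Suc i)"
proof -
  have "Poly_Mapping.lookup (\<Lambda> n m) i = (\<Sum>k\<in>{1..n}. (if k = i then Poly_Mapping.lookup m i else 0) +
      2 * (Poly_Mapping.lookup m k * Poly_Mapping.lookup (cvec k) (Suc i)))"
    unfolding \<Lambda>_def lookup_sum lookup_psc
  proof (intro sum.cong refl)
    fix k
    have "Poly_Mapping.lookup (cvec k) i = (if k = i then 1 else 0) + 2 * Poly_Mapping.lookup (cvec k) (Suc i)"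
      using assms by (auto simp: lookup_cvec Suc_diff_Suc simp flip: power_Suc)
    then show "Poly_Mapping.lookup m k * Poly_Mapping.lookup (cvec k) i =
        (if k = i then Poly_Mapping.lookup m i else 0) +
        2 * (Poly_Mapping.lookup m k * Poly_Mapping.lookup (cvec k) (Suc i))"
      by (simp add: algebra_simps)
  qed
  also have "\<dots> = Poly_Mapping.lookup m i + 2 * Poly_Mapping.lookup (\<Lambda> n m) (Suc i)"
    using assms by (simp add: sum.distrib \<Lambda>_def lookup_sum sum_distrib_left)
  finally show ?thesis .
qed

lemma inj_on_\<Lambda>: "inj_on (\<Lambda> n) (B_exps n)"
proof (rule inj_onI)
  fix m m' assume m: "m \<in> B_exps n" "m' \<in> B_exps n" and eq: "\<Lambda> n m = \<Lambda> n m'"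
  show "m = m'"
  proof (rule poly_mapping_eqI)
    fix i
    show "Poly_Mapping.lookup m i = Poly_Mapping.lookup m' i"
    proof (cases "i \<in> {1..n}")
      case True
      then show ?thesis using lookup_\<Lambda>_step[OF True, of m] lookup_\<Lambda>_step[OF True, of m'] eq by simp
    next
      case False
      then show ?thesis using m supp_outside[of m n i] supp_outside[of m' n i] by (auto simp: B_exps_def)
    qed
  qed
qed

lemma lead_\<Phi>_monomial:
  assumes "m \<in> B_exps n"
  shows "lead (\<Phi> n (Poly_Mapping.single m 1)) (\<Lambda> n m)"
  unfolding \<Phi>_def ev_single \<Lambda>_def
proof (rule lead_prod)
  fix k assume k: "k \<in> {1..n}"
  show "lead (ipow (iter_\<alpha> n k) (Poly_Mapping.lookup m k)) (psc (Poly_Mapping.lookup m k) (cvec k))"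
  proof (cases "Poly_Mapping.lookup m k \<ge> 0")
    case True
    then show ?thesis using lead_power[OF lead_iter_\<alpha>[of k n], of "nat (Poly_Mapping.lookup m k)"] k
      by (simp add: ipow_def)
  next
    case False
    \<comment> \<open>Only the last exponent can be negative, and \<open>iter_\<alpha> n n\<close>
      is a monomial, so its negative powers are monomials as well.\<close>
    with assms k have [simp]: "k = n" by (auto simp: B_exps_def order_le_less)
    have "psc (int (nat (- Poly_Mapping.lookup m n))) (- cvec n) = psc (Poly_Mapping.lookup m n) (cvec n)"
      using False by (intro poly_mapping_eqI) simp
    then show ?thesis
      using lead_power[OF lead_single[of "- cvec n"], of "nat (- Poly_Mapping.lookup m n)"] False
      by (simp add: ipow_inverse[OF iter_\<alpha>_top_inverse])
  qed
qed

text \<open>Different monomials have different leading exponents by injectivity of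
  \<open>\<Lambda> n\<close>, so the largest one survives in the sum.\<close>

lemma lead_\<Phi>:
  assumes p: "p \<in> coord_space (B_exps n)" "p \<noteq> 0"
  shows "\<exists>m\<in>Poly_Mapping.keys p. lead (\<Phi> n p) (\<Lambda> n m)"
proof -
  let ?L = "\<Lambda> n ` Poly_Mapping.keys p"
  have "Max ?L \<in> ?L" using p(2) by (intro Max_in) auto
  then obtain m where m: "m \<in> Poly_Mapping.keys p" "\<Lambda> n m = Max ?L" by auto
  have B_exps: "Poly_Mapping.keys p \<subseteq> B_exps n" using p(1) by (auto simp: coord_space_def)
  define q where "q = p - Poly_Mapping.single m 1"
  have q: "x \<in> Poly_Mapping.keys p \<and> x \<noteq> m" if "x \<in> Poly_Mapping.keys q" for x
    using that m(1) by (cases "x = m") (auto simp: q_def in_keys_iff lookup_minus lookup_single)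
  have "\<Phi> n q \<in> coord_space {..<\<Lambda> n m}"
  proof (rule lin_mem_subspace[OF lin_\<Phi> coord_space_subspace])
    fix x assume "x \<in> Poly_Mapping.keys q"
    then have x: "x \<in> Poly_Mapping.keys p" "x \<noteq> m" using q by auto
    then have "\<Lambda> n x \<le> \<Lambda> n m" using m(2) by simp
    moreover have "\<Lambda> n x \<noteq> \<Lambda> n m" using x m(1) B_exps inj_onD[OF inj_on_\<Lambda>[of n], of x m] by auto
    ultimately show "\<Phi> n (Poly_Mapping.single x 1) \<in> coord_space {..<\<Lambda> n m}"
      using lead_\<Phi>_monomial[of x n] x B_exps by (intro lead_less_coord_space[of _ "\<Lambda> n x"]) auto
  qed
  moreover have "\<Phi> n p = \<Phi> n (Poly_Mapping.single m 1) + \<Phi> n q"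
    by (simp add: q_def flip: lin_add[OF lin_\<Phi>])
  ultimately have "lead (\<Phi> n p) (\<Lambda> n m)"
    using lead_add[OF lead_\<Phi>_monomial] m(1) B_exps by auto
  then show ?thesis using m(1) by blast
qed

lemma inj_on_\<Phi>: "inj_on (\<Phi> n) (coord_space (B_exps n))"
proof (rule inj_on_linI[OF lin_\<Phi> coord_space_subspace])
  fix p assume "p \<in> coord_space (B_exps n)" "\<Phi> n p = 0"
  then show "p = 0" using lead_\<Phi>[of p n] by (auto simp: lead_def)
qed


section \<open>The graded coalgebra axioms\<close>

definition assoc :: "('a \<times> 'b) \<times> 'c \<Rightarrow> 'a \<times> 'b \<times> 'c" where
  "assoc = (\<lambda>((a, b), c). (a, (b, c)))"

lemma push_assoc_tens: "push assoc (tens (tens u v) w) = tens u (tens v w)"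
  for u :: "'a \<Rightarrow>\<^sub>0 'k::field" and v :: "'b \<Rightarrow>\<^sub>0 'k" and w :: "'c \<Rightarrow>\<^sub>0 'k"
proof (rule poly_mapping_eqI)
  fix x :: "'a \<times> 'b \<times> 'c"
  obtain a b c where x: "x = assoc ((a, b), c)" by (cases x) (auto simp: assoc_def)
  have "inj_on (assoc :: ('a \<times> 'b) \<times> 'c \<Rightarrow> _) UNIV" by (auto simp: inj_on_def assoc_def)
  then have "Poly_Mapping.lookup (push assoc (tens (tens u v) w)) x =
      Poly_Mapping.lookup (tens (tens u v) w) ((a, b), c)"
    unfolding x by (rule lookup_push_inj) auto
  then show "Poly_Mapping.lookup (push assoc (tens (tens u v) w)) x =
      Poly_Mapping.lookup (tens u (tens v w)) x"
    by (simp add: x assoc_def mult.assoc)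
qed

lemma push_assoc_tmap: "push assoc (tmap (tmap f g) h p) = tmap f (tmap g h) (push assoc p)"
proof (rule lin_eq_on_keys[where p = p])
  show "lin (\<lambda>p. push assoc (tmap (tmap f g) h p))" "lin (\<lambda>p. tmap f (tmap g h) (push assoc p))"
    by (intro lin_comp[OF lin_push lin_tmap] lin_comp[OF lin_tmap lin_push])+
  show "push assoc (tmap (tmap f g) h (Poly_Mapping.single x 1)) =
      tmap f (tmap g h) (push assoc (Poly_Mapping.single x 1))" for x
    by (cases x) (auto simp: tmap_single push_single push_assoc_tens, simp add: assoc_def tmap_single)
qed

lemma split_vars_assoc:
  "assoc (map_prod (split_vars i) id (split_vars (i + j) m)) =
   map_prod id (split_vars j) (split_vars i m)"
proof -
  have "fst (split_vars i (fst (split_vars (i + j) m))) = fst (split_vars i m)"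
    "snd (split_vars i (fst (split_vars (i + j) m))) = fst (split_vars j (snd (split_vars i m)))"
    "snd (split_vars (i + j) m) = snd (split_vars j (snd (split_vars i m)))"
    by (auto intro!: poly_mapping_eqI simp: lookup_split_vars ac_simps)
  then show ?thesis by (simp add: assoc_def split_beta map_prod_def)
qed

text \<open>After the injective map \<open>\<Phi>\<close> is applied in all three factors, both
  sides are the splitting of \<open>\<Phi> (i + j + k) p\<close> into three blocks of variables, and
  the order of the two cuts is irrelevant.\<close>

lemma \<Delta>_coassoc:
  assumes p: "p \<in> coord_space (B_exps (i + j + k))"
  shows "push assoc (tmap (\<Delta> i j) id (\<Delta> (i + j) k p)) = tmap id (\<Delta> j k) (\<Delta> i (j + k) p)"
proof (rule inj_onD[OF inj_on_tmap[OF lin_\<Phi> lin_tmap inj_on_\<Phi> inj_on_tmap[OF lin_\<Phi> lin_\<Phi> inj_on_\<Phi> inj_on_\<Phi>]]])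
  have p': "p \<in> coord_space (B_exps (i + (j + k)))" using p by (simp add: add.assoc)
  let ?q = "\<Delta> (i + j) k p" and ?r = "\<Delta> i (j + k) p"
  have q: "?q \<in> coord_space (B_exps (i + j) \<times> B_exps k)" by (rule \<Delta>_coord_space_B[OF p])
  have r: "?r \<in> coord_space (B_exps i \<times> B_exps (j + k))" by (rule \<Delta>_coord_space_B[OF p'])
  have "tmap (\<Phi> i) (tmap (\<Phi> j) (\<Phi> k)) (push assoc (tmap (\<Delta> i j) id ?q)) =
      push assoc (tmap (\<lambda>x. tmap (\<Phi> i) (\<Phi> j) (\<Delta> i j x)) (\<lambda>x. \<Phi> k (id x)) ?q)"
    by (simp add: tmap_tmap[OF lin_tmap lin_\<Phi>] flip: push_assoc_tmap)
  \<comment> \<open>Writing the identity on the third factor as \<open>push id\<close> lets the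
    composite be taken apart into pushes along the two cuts.\<close>
  also have "tmap (\<lambda>x. tmap (\<Phi> i) (\<Phi> j) (\<Delta> i j x)) (\<lambda>x. \<Phi> k (id x)) ?q =
      tmap (\<lambda>x. push (split_vars i) (\<Phi> (i + j) x)) (\<lambda>x. push id (\<Phi> k x)) ?q"
    by (rule tmap_eq_on_coord_space[OF _ _ q]) (auto simp: \<Phi>_\<Delta> push_ident)
  also have "\<dots> = push (map_prod (split_vars i) id) (push (split_vars (i + j)) (\<Phi> (i + j + k) p))"
    by (subst tmap_tmap[OF lin_push lin_push, symmetric]) (simp add: tmap_push \<Phi>_\<Delta>[OF p])
  also have "push assoc \<dots> =
      push (map_prod id (split_vars j)) (push (split_vars i) (\<Phi> (i + (j + k)) p))"
    by (simp add: push_push split_vars_assoc add.assoc)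
  also have "\<dots> = tmap (\<lambda>x. push id (\<Phi> i x)) (\<lambda>x. push (split_vars j) (\<Phi> (j + k) x)) ?r"
    by (subst tmap_tmap[OF lin_push lin_push, symmetric]) (simp add: tmap_push \<Phi>_\<Delta>[OF p'])
  also have "\<dots> = tmap (\<lambda>x. \<Phi> i (id x)) (\<lambda>x. tmap (\<Phi> j) (\<Phi> k) (\<Delta> j k x)) ?r"
    by (rule tmap_eq_on_coord_space[OF _ _ r]) (auto simp: \<Phi>_\<Delta> push_ident)
  also have "\<dots> = tmap (\<Phi> i) (tmap (\<Phi> j) (\<Phi> k)) (tmap id (\<Delta> j k) ?r)"
    by (simp add: tmap_tmap[OF lin_\<Phi> lin_tmap])
  finally show "tmap (\<Phi> i) (tmap (\<Phi> j) (\<Phi> k)) (push assoc (tmap (\<Delta> i j) id ?q)) =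
      tmap (\<Phi> i) (tmap (\<Phi> j) (\<Phi> k)) (tmap id (\<Delta> j k) ?r)" .
  have "tmap (\<Delta> i j) id ?q \<in> coord_space ((B_exps i \<times> B_exps j) \<times> B_exps k)"
    using tmap_in_tensor[OF _ _ q, of "\<Delta> i j" "coord_space (B_exps i \<times> B_exps j)" id "coord_space (B_exps k)"]
    by (simp add: \<Delta>_coord_space_B tensor_coord_space)
  from push_coord_space[OF this, of assoc] have "push assoc (tmap (\<Delta> i j) id ?q) \<in> coord_space (assoc ` ((B_exps i \<times> B_exps j) \<times> B_exps k))" .
  also have "assoc ` ((B_exps i \<times> B_exps j) \<times> B_exps k) = B_exps i \<times> B_exps j \<times> B_exps k"
    by (auto simp: assoc_def image_iff)
  finally show "push assoc (tmap (\<Delta> i j) id ?q) \<in> coord_space (B_exps i \<times> B_exps j \<times> B_exps k)" .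
  show "tmap id (\<Delta> j k) ?r \<in> coord_space (B_exps i \<times> B_exps j \<times> B_exps k)"
    using tmap_in_tensor[OF _ _ r, of id "coord_space (B_exps i)" "\<Delta> j k" "coord_space (B_exps j \<times> B_exps k)"]
    by (simp add: \<Delta>_coord_space_B tensor_coord_space)
qed

definition sub_coalg :: "(nat \<Rightarrow> (nat \<Rightarrow>\<^sub>0 int) set) \<Rightarrow> (nat \<Rightarrow>\<^sub>0 int, bit) gcoalg" where
  "sub_coalg M = \<lparr>piece = (\<lambda>n. coord_space (M n)), coprod = \<Delta>, counit = (\<lambda>p. Poly_Mapping.lookup p 0)\<rparr>"

lemma B_coalg_eq: "B_coalg = sub_coalg B_exps"
  and Bplus_coalg_eq: "Bplus_coalg = sub_coalg Bplus_exps"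
  by (simp_all add: B_coalg_def Bplus_coalg_def sub_coalg_def B_eq[abs_def] Bplus_eq[abs_def])

text \<open>Coassociativity and the counit laws are inherited from \<open>B n\<close>; what depends
  on \<open>M\<close> is closure under the coproduct.\<close>

lemma graded_coalgebra_sub_coalg:
  assumes M: "\<And>n. M n \<subseteq> B_exps n" "0 \<in> M 0"
    and \<Delta>: "\<And>i j p. p \<in> coord_space (M (i + j)) \<Longrightarrow> \<Delta> i j p \<in> coord_space (M i \<times> M j)"
  shows "graded_coalgebra (sub_coalg M)"
proof -
  have B_exps: "p \<in> coord_space (B_exps n)" if "p \<in> coord_space (M n)" for p n
    using that coord_space_mono[OF M(1)] by blast
  have one: "1 \<in> coord_space (M 0)" using M(2) by (simp flip: single_one)
  have coassoc: "push (\<lambda>((a, b), c). (a, (b, c)))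
      (tensor_map (coord_space (M (i + j))) (coord_space (M k)) (\<Delta> i j) id (\<Delta> (i + j) k p)) =
      tensor_map (coord_space (M i)) (coord_space (M (j + k))) id (\<Delta> j k) (\<Delta> i (j + k) p)"
    if p: "p \<in> coord_space (M (i + j + k))" for i j k p
    using \<Delta>[OF p] \<Delta>[of p i "j + k"] p \<Delta>_coassoc[OF B_exps[OF p]]
    by (simp add: tensor_map_eq_tmap lin_\<Delta> lin_id coord_space_subspace tensor_coord_space assoc_def add.assoc)
  have counit: "tensor_lift psc (coord_space (M 0)) (coord_space (M n)) (\<lambda>u w. psc (Poly_Mapping.lookup u 0) w) (\<Delta> 0 n p) = p"
    "tensor_lift psc (coord_space (M n)) (coord_space (M 0)) (\<lambda>u w. psc (Poly_Mapping.lookup w 0) u) (\<Delta> n 0 p) = p"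
    if p: "p \<in> coord_space (M n)" for n p
  proof -
    have "tensor_lift psc (coord_space (M 0)) (coord_space (M n)) (\<lambda>u w. psc (Poly_Mapping.lookup u 0) w) (tens 1 p) =
        psc (Poly_Mapping.lookup (1 :: laurent) 0) p"
      by (rule tensor_lift_exists(2)[OF pm.vector_space_axioms coord_space_subspace coord_space_subspace _ _ one p])
         (auto simp: lin_on_def lookup_add pm.scale_left_distrib pm.scale_right_distrib mult.commute)
    then show "tensor_lift psc (coord_space (M 0)) (coord_space (M n)) (\<lambda>u w. psc (Poly_Mapping.lookup u 0) w) (\<Delta> 0 n p) = p"
      by (simp add: \<Delta>_0_left[OF B_exps[OF p]])
    have "tensor_lift psc (coord_space (M n)) (coord_space (M 0)) (\<lambda>u w. psc (Poly_Mapping.lookup w 0) u) (tens p 1) =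
        psc (Poly_Mapping.lookup (1 :: laurent) 0) p"
      by (rule tensor_lift_exists(2)[OF pm.vector_space_axioms coord_space_subspace coord_space_subspace _ _ p one])
         (auto simp: lin_on_def lookup_add pm.scale_left_distrib pm.scale_right_distrib mult.commute)
    then show "tensor_lift psc (coord_space (M n)) (coord_space (M 0)) (\<lambda>u w. psc (Poly_Mapping.lookup w 0) u) (\<Delta> n 0 p) = p"
      by (simp add: \<Delta>_0_right[OF B_exps[OF p]])
  qed
  show ?thesis
    unfolding graded_coalgebra_def sub_coalg_def
  proof (simp only: gcoalg.simps, intro conjI allI ballI)
    show "pm.subspace (coord_space (M n))" for n by (rule coord_space_subspace)
    show "lin_on psc (coord_space (M (i + j))) (\<Delta> i j)" for i j by (rule lin_on_mono[OF lin_\<Delta> subset_UNIV])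
    show "lin_on (*) (coord_space (M 0)) (\<lambda>p. Poly_Mapping.lookup p 0)" by (simp add: lin_on_def lookup_add)
  qed (simp_all add: coassoc counit \<Delta> tensor_coord_space)
qed


section \<open>Words and spaces of tensors\<close>

definition words :: "nat \<Rightarrow> 'a set \<Rightarrow> 'a list set" where
  "words n M = {w. length w = n \<and> set w \<subseteq> M}"

lemma push_image_coord_space: "push g ` coord_space S = coord_space (g ` S)"
proof
  show "push g ` coord_space S \<subseteq> coord_space (g ` S)" by (auto intro: push_coord_space)
  have "Poly_Mapping.single (g x) 1 \<in> push g ` coord_space S" if "x \<in> S" for x
    using that by (intro image_eqI[of _ _ "Poly_Mapping.single x 1"]) (auto simp: push_single)
  then show "coord_space (g ` S) \<subseteq> push g ` coord_space S"
    by (subst coord_space_subset_iff) (auto intro: lin_image_subspace lin_push coord_space_subspace)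
qed

lemma cat_space_subspace: "pm.subspace (cat_space A C)"
  unfolding cat_space_def by (rule pm.subspace_span)

lemma cat_in_cat_space: "a \<in> A \<Longrightarrow> b \<in> C \<Longrightarrow> cat a b \<in> cat_space A C"
  unfolding cat_space_def by (rule pm.span_base) blast

lemma cat_space_minimal:
  assumes "pm.subspace U" "\<And>a b. a \<in> A \<Longrightarrow> b \<in> C \<Longrightarrow> cat a b \<in> U"
  shows "cat_space A C \<subseteq> U"
  unfolding cat_space_def by (rule pm.span_minimal[OF _ assms(1)]) (use assms(2) in auto)

lemma cat_space_mono: "A \<subseteq> A' \<Longrightarrow> C \<subseteq> C' \<Longrightarrow> cat_space A C \<subseteq> cat_space A' C'"
  by (rule cat_space_minimal[OF cat_space_subspace]) (auto intro: cat_in_cat_space)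

lemma push_append_tensor:
  assumes "t \<in> tensor A C"
  shows "push (\<lambda>(x, y). x @ y) t \<in> cat_space A C"
proof -
  let ?f = "push (\<lambda>(x, y). x @ y)"
  have "pm.subspace {t. ?f t \<in> cat_space A C}"
    by (rule pm.subspaceI)
       (auto simp: lin_0[OF lin_push] lin_add[OF lin_push] lin_psc[OF lin_push]
         pm.subspace_0 pm.subspace_add pm.subspace_scale cat_space_subspace)
  then have "tensor A C \<subseteq> {t. ?f t \<in> cat_space A C}"
    unfolding tensor_def by (rule pm.span_minimal[rotated]) (auto simp: cat_in_cat_space simp flip: cat_def)
  then show ?thesis using assms by auto
qed

lemma cat_space_coord_space:
  "cat_space (coord_space S) (coord_space T) = (coord_space {x @ y | x y. x \<in> S \<and> y \<in> T} :: ('a list \<Rightarrow>\<^sub>0 'b::field) set)"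
  (is "?L = ?R")
proof
  show "?L \<subseteq> ?R"
  proof (rule cat_space_minimal[OF coord_space_subspace])
    fix a b :: "'a list \<Rightarrow>\<^sub>0 'b" assume "a \<in> coord_space S" "b \<in> coord_space T"
    then have "tens a b \<in> coord_space (S \<times> T)" by (auto simp: coord_space_def keys_tens)
    from push_coord_space[OF this, of "\<lambda>(x, y). x @ y"]
    show "cat a b \<in> coord_space {x @ y | x y. x \<in> S \<and> y \<in> T}"
      unfolding cat_def by (rule subsetD[OF coord_space_mono, rotated]) auto
  qed
  have "Poly_Mapping.single (x @ y) (1 :: 'b) \<in> cat_space (coord_space S) (coord_space T)" if "x \<in> S" "y \<in> T" for x y
    using cat_in_cat_space[of "Poly_Mapping.single x (1 :: 'b)" "coord_space S" "Poly_Mapping.single y 1" "coord_space T"] that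
    by (simp add: cat_def tens_single push_single)
  then show "?R \<subseteq> ?L"
    by (subst coord_space_subset_iff) (auto simp: cat_space_subspace)
qed

lemma tpow_coord_space: "tpow (coord_space M) n = coord_space (words n M)"
proof (induction n)
  case 0
  have "pm.span {Poly_Mapping.single [] 1} = coord_space {[] :: 'a list}"
  proof
    show "pm.span {Poly_Mapping.single [] 1} \<subseteq> coord_space {[]}"
      by (rule pm.span_minimal[OF _ coord_space_subspace]) auto
    show "coord_space {[]} \<subseteq> pm.span {Poly_Mapping.single [] 1}"
      by (subst coord_space_subset_iff) (auto intro: pm.subspace_span pm.span_base)
  qed
  moreover have "words 0 M = {[]}" by (auto simp: words_def)
  ultimately show ?case by simp
next
  case (Suc n)
  have "{x @ y | x y. x \<in> (\<lambda>a. [a]) ` M \<and> y \<in> words n M} = words (Suc n) M"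
  proof (intro equalityI subsetI)
    fix w assume "w \<in> words (Suc n) M"
    then obtain a w' where "w = [a] @ w'" "a \<in> M" "w' \<in> words n M" by (cases w) (auto simp: words_def)
    then show "w \<in> {x @ y | x y. x \<in> (\<lambda>a. [a]) ` M \<and> y \<in> words n M}" by blast
  qed (auto simp: words_def)
  then show ?case by (simp add: Suc letters_def push_image_coord_space cat_space_coord_space)
qed

text \<open>All words of the left factor have length \<open>i\<close>, so a word can be cut in one
  way only and no coefficients add up.\<close>

lemma lookup_cat_left:
  assumes "a \<in> coord_space (words i M)" "length u = i"
  shows "Poly_Mapping.lookup (cat a c) (u @ w) = Poly_Mapping.lookup a u * Poly_Mapping.lookup c w"
proof -
  let ?S = "{(x, y :: 'a list). length x = i}"
  have "inj_on (\<lambda>(x, y). x @ y) ?S" by (auto simp: inj_on_def)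
  moreover have "Poly_Mapping.keys (tens a c) \<subseteq> ?S" using assms(1) by (auto simp: keys_tens coord_space_def words_def)
  ultimately show ?thesis
    using lookup_push_inj[of "\<lambda>(x, y). x @ y" ?S "tens a c" "(u, w)"] assms(2) by (simp add: cat_def)
qed

lemma lookup_cat_right:
  assumes "b \<in> coord_space (words j M)" "length v = j"
  shows "Poly_Mapping.lookup (cat c b) (w @ v) = Poly_Mapping.lookup c w * Poly_Mapping.lookup b v"
proof -
  let ?S = "{(x :: 'a list, y). length y = j}"
  have "inj_on (\<lambda>(x, y). x @ y) ?S" by (auto simp: inj_on_def)
  moreover have "Poly_Mapping.keys (tens c b) \<subseteq> ?S" using assms(1) by (auto simp: keys_tens coord_space_def words_def)
  ultimately show ?thesis
    using lookup_push_inj[of "\<lambda>(x, y). x @ y" ?S "tens c b" "(w, v)"] assms(2) by (simp add: cat_def)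
qed

text \<open>Contraction of a tensor with the coordinate functionals of the prefix \<open>u\<close>
  and the suffix \<open>v\<close>.\<close>

definition slice :: "'a list \<Rightarrow> 'a list \<Rightarrow> ('a list \<Rightarrow>\<^sub>0 'k::field) \<Rightarrow> ('a list \<Rightarrow>\<^sub>0 'k)" where
  "slice u v = Poly_Mapping.map_key (\<lambda>w. u @ w @ v)"

lemma lookup_slice: "Poly_Mapping.lookup (slice u v f) w = Poly_Mapping.lookup f (u @ w @ v)"
proof -
  have "inj (\<lambda>w. u @ w @ v)" by (auto simp: inj_def)
  then show ?thesis by (simp add: slice_def map_key.rep_eq)
qed

lemma lin_slice: "lin (slice u v)"
  by (auto simp: lin_on_def lookup_slice lookup_add intro!: poly_mapping_eqI)

lemma lin_vimage_subspace: "lin f \<Longrightarrow> pm.subspace U \<Longrightarrow> pm.subspace {x. f x \<in> U}"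
  by (rule pm.subspaceI) (auto simp: lin_0 lin_add lin_psc pm.subspace_0 pm.subspace_add pm.subspace_scale)

text \<open>Contracting an outer factor of a pure tensor leaves a scalar multiple of the remaining
  one, which stays in its subspace. The prefix is removed first, then the suffix.\<close>

lemma slice_cat_space:
  fixes f :: "'a list \<Rightarrow>\<^sub>0 'k::field"
  assumes R: "pm.subspace R" and uv: "length u = i" "length v = j"
    and f: "f \<in> cat_space (coord_space (words i M)) (cat_space R (coord_space (words j M)))"
  shows "slice u v f \<in> R"
proof -
  have l: "slice u [] g \<in> cat_space R (coord_space (words j M))"
    if "g \<in> cat_space (coord_space (words i M)) (cat_space R (coord_space (words j M)))" for g
  proof -
    have "cat_space (coord_space (words i M)) (cat_space R (coord_space (words j M))) \<subseteq> {g. slice u [] g \<in> cat_space R (coord_space (words j M))}"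
    proof (rule cat_space_minimal)
      fix a b :: "'a list \<Rightarrow>\<^sub>0 'k" assume a: "a \<in> coord_space (words i M)" and b: "b \<in> cat_space R (coord_space (words j M))"
      have "slice u [] (cat a b) = psc (Poly_Mapping.lookup a u) b"
        by (rule poly_mapping_eqI) (simp add: lookup_slice lookup_cat_left[OF a uv(1)])
      then show "cat a b \<in> {g. slice u [] g \<in> cat_space R (coord_space (words j M))}"
        using b by (simp add: pm.subspace_scale cat_space_subspace)
    qed (intro lin_vimage_subspace lin_slice cat_space_subspace)
    then show ?thesis using that by auto
  qed
  have r: "slice [] v g \<in> R" if "g \<in> cat_space R (coord_space (words j M))" for g
  proof -
    have "cat_space R (coord_space (words j M)) \<subseteq> {g. slice [] v g \<in> R}"
    proof (rule cat_space_minimal)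
      fix a b :: "'a list \<Rightarrow>\<^sub>0 'k" assume a: "a \<in> R" and b: "b \<in> coord_space (words j M)"
      have "slice [] v (cat a b) = psc (Poly_Mapping.lookup b v) a"
        by (rule poly_mapping_eqI) (simp add: lookup_slice lookup_cat_right[OF b uv(2)] mult.commute)
      then show "cat a b \<in> {g. slice [] v g \<in> R}"
        using a R by (simp add: pm.subspace_scale)
    qed (intro lin_vimage_subspace lin_slice R)
    then show ?thesis using that by auto
  qed
  have "slice [] v (slice u [] f) = slice u v f"
    by (rule poly_mapping_eqI) (simp add: lookup_slice)
  with r[OF l[OF f]] show ?thesis by simp
qed


section \<open>The iterated coproduct with values in words\<close>

definition supp :: "nat \<Rightarrow> (nat \<Rightarrow>\<^sub>0 int) set" where
  "supp n = {m. Poly_Mapping.keys m \<subseteq> {1..n}}"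

text \<open>Variable \<open>Suc k\<close> of the large ring becomes the variable
  \<open>\<alpha> 1\<close> of the \<open>k\<close>-th tensor factor \<open>B 1\<close>.\<close>

definition word :: "nat \<Rightarrow> (nat \<Rightarrow>\<^sub>0 int) \<Rightarrow> (nat \<Rightarrow>\<^sub>0 int) list" where
  "word n m = map (\<lambda>k. Poly_Mapping.single 1 (Poly_Mapping.lookup m (Suc k))) [0..<n]"

lemma length_word [simp]: "length (word n m) = n"
  by (simp add: word_def)

lemma nth_word [simp]: "k < n \<Longrightarrow> word n m ! k = Poly_Mapping.single 1 (Poly_Mapping.lookup m (Suc k))"
  by (simp add: word_def)

lemma supp_eqI:
  assumes "m \<in> supp n" "m' \<in> supp n"
    and "\<And>k. k < n \<Longrightarrow> Poly_Mapping.lookup m (Suc k) = Poly_Mapping.lookup m' (Suc k)"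
  shows "m = m'"
proof (rule poly_mapping_eqI)
  fix k
  show "Poly_Mapping.lookup m k = Poly_Mapping.lookup m' k"
    using assms(3)[of "k - 1"] assms(1,2) supp_outside[of m n k] supp_outside[of m' n k]
    by (cases "k \<in> {1..n}") (auto simp: supp_def)
qed

lemma inj_on_word: "inj_on (word n) (supp n)"
proof (rule inj_onI)
  fix m m' assume m: "m \<in> supp n" "m' \<in> supp n" and eq: "word n m = word n m'"
  show "m = m'"
  proof (rule supp_eqI[OF m])
    fix k assume "k < n"
    then have "Poly_Mapping.single (1::nat) (Poly_Mapping.lookup m (Suc k)) =
        Poly_Mapping.single 1 (Poly_Mapping.lookup m' (Suc k))"
      using arg_cong[OF eq, of "\<lambda>w. w ! k"] by simp
    then show "Poly_Mapping.lookup m (Suc k) = Poly_Mapping.lookup m' (Suc k)"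
      by (metis lookup_single_eq)
  qed
qed

definition unword :: "(nat \<Rightarrow>\<^sub>0 int) list \<Rightarrow> (nat \<Rightarrow>\<^sub>0 int)" where
  "unword w = (\<Sum>k<length w. Poly_Mapping.single (Suc k) (Poly_Mapping.lookup (w ! k) 1))"

lemma lookup_unword: "Poly_Mapping.lookup (unword w) k =
    (if k \<in> {1..length w} then Poly_Mapping.lookup (w ! (k - 1)) 1 else 0)"
proof -
  have "Poly_Mapping.lookup (unword w) k =
      (\<Sum>l<length w. if l = k - 1 then (if k > 0 then Poly_Mapping.lookup (w ! (k - 1)) 1 else 0) else 0)"
    unfolding unword_def lookup_sum
    by (intro sum.cong refl) (auto simp: lookup_single when_def)
  then show ?thesis by auto
qed

lemma unword_supp: "length w = n \<Longrightarrow> unword w \<in> supp n"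
  by (auto simp: supp_def in_keys_iff lookup_unword split: if_splits)

lemma single_B_exps_1: "Poly_Mapping.single (Suc 0) a \<in> B_exps (Suc 0)"
  using single_B_exps_top[of 1 a] by simp

lemma B_exps_1D: "x \<in> B_exps (Suc 0) \<Longrightarrow> Poly_Mapping.single (Suc 0) (Poly_Mapping.lookup x (Suc 0)) = x"
  by (rule supp_eqI[of _ 1]) (auto simp: B_exps_def supp_def)

lemma word_unword:
  assumes "w \<in> words n (B_exps 1)"
  shows "word n (unword w) = w"
proof (rule nth_equalityI)
  fix k assume "k < length (word n (unword w))"
  then have "k < n" "w ! k \<in> B_exps 1" "length w = n" using assms by (auto simp: words_def subset_iff)
  then show "word n (unword w) ! k = w ! k" by (simp add: lookup_unword B_exps_1D)
qed (use assms in \<open>auto simp: words_def\<close>)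

lemma word_mem_words_B_exps: "word n m \<in> words n (B_exps 1)"
  by (auto simp: words_def word_def single_B_exps_1)

lemma word_mem_words_Bplus_exps: "m \<in> Bplus_exps n \<Longrightarrow> word n m \<in> words n (Bplus_exps 1)"
  by (auto simp: words_def word_def Bplus_exps_def lookup_single when_def split: if_splits)

lemma word_split: "map_prod (word i) (word j) (split_vars i m) =
    (take i (word (i + j) m), drop i (word (i + j) m))"
  by (auto intro!: prod_eqI nth_equalityI simp: lookup_split_vars ac_simps)

text \<open>In degree \<open>n\<close> this becomes the isomorphism onto the quadratic coalgebra.
  \<open>\<Phi>\<close> is kept apart since leading terms are computed in a ring.\<close>

definition \<phi> :: "nat \<Rightarrow> laurent \<Rightarrow> ((nat \<Rightarrow>\<^sub>0 int) list \<Rightarrow>\<^sub>0 bit)" where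
  "\<phi> n p = push (word n) (\<Phi> n p)"

lemma lin_\<phi>: "lin (\<phi> n)"
  unfolding \<phi>_def by (rule lin_comp[OF lin_push lin_\<Phi>])

lemma Bplus_exps_subset_supp: "Bplus_exps n \<subseteq> supp n"
  by (auto simp: Bplus_exps_def supp_def)

lemma \<Phi>_coord_space_Bplus_exps: "p \<in> coord_space (Bplus_exps n) \<Longrightarrow> \<Phi> n p \<in> coord_space (Bplus_exps n)"
  unfolding \<Phi>_def by (rule ev_coord_space_Bplus) (auto simp: add_closed_Bplus_exps iter_\<alpha>_coord_space)

lemma add_closed_supp: "add_closed (supp n)"
  using Poly_Mapping.keys_add unfolding add_closed_def supp_def by fastforce

lemma cvec_supp: "cvec n \<in> supp n" "- cvec n \<in> supp n"
  by (auto simp: supp_def in_keys_iff lookup_cvec split: if_splits)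

lemma \<Phi>_coord_space_supp: "p \<in> coord_space (B_exps n) \<Longrightarrow> \<Phi> n p \<in> coord_space (supp n)"
  unfolding \<Phi>_def
  by (rule ev_coord_space_B[OF _ _ iter_\<alpha>_top_inverse])
     (use iter_\<alpha>_coord_space coord_space_mono[OF Bplus_exps_subset_supp] in \<open>auto simp: add_closed_supp cvec_supp\<close>)

lemma \<phi>_coord_space_B_exps: "p \<in> coord_space (B_exps n) \<Longrightarrow> \<phi> n p \<in> coord_space (words n (B_exps 1))"
  unfolding \<phi>_def by (rule subsetD[OF coord_space_mono push_coord_space[OF \<Phi>_coord_space_supp]]) (use word_mem_words_B_exps in auto)

lemma \<phi>_coord_space_Bplus_exps: "p \<in> coord_space (Bplus_exps n) \<Longrightarrow> \<phi> n p \<in> coord_space (words n (Bplus_exps 1))"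
  unfolding \<phi>_def by (rule subsetD[OF coord_space_mono push_coord_space[OF \<Phi>_coord_space_Bplus_exps]]) (use word_mem_words_Bplus_exps in auto)

lemma inj_on_\<phi>: "inj_on (\<phi> n) (coord_space (B_exps n))"
proof -
  have "inj_on (push (word n) :: laurent \<Rightarrow> _) (coord_space (supp n))"
  proof (rule inj_on_linI[OF lin_push coord_space_subspace])
    fix p :: laurent assume p: "p \<in> coord_space (supp n)" "push (word n) p = 0"
    have "Poly_Mapping.lookup p m = 0" for m
      using lookup_push_inj[OF inj_on_word, of p n m] p by (cases "m \<in> supp n") (auto simp: coord_space_def in_keys_iff)
    then show "p = 0" by (intro poly_mapping_eqI) simp
  qed
  then have "inj_on (push (word n)) (\<Phi> n ` coord_space (B_exps n))"
    by (rule inj_on_subset) (use \<Phi>_coord_space_supp in blast)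
  from comp_inj_on[OF inj_on_\<Phi> this] show ?thesis by (simp add: comp_def \<phi>_def[abs_def])
qed

lemma \<phi>_\<Delta>:
  assumes "p \<in> coord_space (B_exps (i + j))"
  shows "tmap (\<phi> i) (\<phi> j) (\<Delta> i j p) = push (\<lambda>w. (take i w, drop i w)) (\<phi> (i + j) p)"
proof -
  have "tmap (\<phi> i) (\<phi> j) (\<Delta> i j p) = tmap (push (word i)) (push (word j)) (tmap (\<Phi> i) (\<Phi> j) (\<Delta> i j p))"
    by (simp add: tmap_tmap[OF lin_push lin_push] \<phi>_def[abs_def])
  also have "\<dots> = push (\<lambda>w. (take i w, drop i w)) (\<phi> (i + j) p)"
    by (simp add: tmap_push \<Phi>_\<Delta>[OF assms] \<phi>_def push_push word_split)
  finally show ?thesis .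
qed

text \<open>Cutting every word after \<open>i\<close> letters and gluing it again changes nothing;
  by \<open>\<phi>_\<Delta>\<close> the cut tensor lies in the tensor product of the two
  images.\<close>

lemma \<phi>_cat_space:
  assumes "M (i + j) \<subseteq> B_exps (i + j)" "\<Delta> i j p \<in> coord_space (M i \<times> M j)" "p \<in> coord_space (M (i + j))"
  shows "\<phi> (i + j) p \<in> cat_space (\<phi> i ` coord_space (M i)) (\<phi> j ` coord_space (M j))"
proof -
  have "\<phi> (i + j) p = push (\<lambda>(x, y). x @ y) (push (\<lambda>w. (take i w, drop i w)) (\<phi> (i + j) p))"
    by (simp add: push_push push_ident)
  also have "\<dots> = push (\<lambda>(x, y). x @ y) (tmap (\<phi> i) (\<phi> j) (\<Delta> i j p))"
    using assms(3) coord_space_mono[OF assms(1)] by (subst \<phi>_\<Delta>) auto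
  also have "\<dots> \<in> cat_space (\<phi> i ` coord_space (M i)) (\<phi> j ` coord_space (M j))"
    by (rule push_append_tensor, rule tmap_in_tensor[OF _ _ assms(2)]) auto
  finally show ?thesis .
qed


section \<open>Descent along leading monomials\<close>

text \<open>The only consequence of the relations that the descent uses. It refers to
  \<open>B 2\<close> for both coalgebras; nonnegativity in the case of \<open>Bplus\<close> is
  tracked through the support.\<close>

definition quadratic_words :: "nat \<Rightarrow> ((nat \<Rightarrow>\<^sub>0 int) list \<Rightarrow>\<^sub>0 bit) set" where
  "quadratic_words n = {f. \<forall>u v. length u + length v + 2 = n \<longrightarrow> slice u v f \<in> \<phi> 2 ` coord_space (B_exps 2)}"

lemma R_subspace: "pm.subspace (\<phi> 2 ` coord_space S)"
  by (rule lin_image_subspace[OF lin_\<phi> coord_space_subspace])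

lemma quadratic_words_diff:
  "f \<in> quadratic_words n \<Longrightarrow> g \<in> quadratic_words n \<Longrightarrow> f - g \<in> quadratic_words n"
  by (auto simp: quadratic_words_def lin_diff[OF lin_slice] intro!: pm.subspace_diff R_subspace)

lemma cat_space_quadratic_words:
  assumes "\<And>i j. i + j + 2 = n \<Longrightarrow> f \<in> cat_space (coord_space (words i (B_exps 1))) (cat_space (\<phi> 2 ` coord_space (B_exps 2)) (coord_space (words j (B_exps 1))))"
  shows "f \<in> quadratic_words n"
  unfolding quadratic_words_def using slice_cat_space[OF R_subspace refl refl assms] by blast

text \<open>Two successive coproducts isolate a middle block of two letters, whose component comes
  from \<open>M 2\<close>; this is why images satisfy every relation.\<close>

lemma \<phi>_triple:
  assumes M: "\<And>n. M n \<subseteq> B_exps n" and \<Delta>: "\<And>i j p. p \<in> coord_space (M (i + j)) \<Longrightarrow> \<Delta> i j p \<in> coord_space (M i \<times> M j)"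
    and words: "\<And>n p. p \<in> coord_space (M n) \<Longrightarrow> \<phi> n p \<in> coord_space (words n (M 1))"
    and p: "p \<in> coord_space (M n)" and n: "i + j + 2 = n"
  shows "\<phi> n p \<in> cat_space (coord_space (words i (M 1))) (cat_space (\<phi> 2 ` coord_space (M 2)) (coord_space (words j (M 1))))"
proof -
  have n': "n = i + (2 + j)" using n by simp
  have "\<phi> n p \<in> cat_space (\<phi> i ` coord_space (M i)) (\<phi> (2 + j) ` coord_space (M (2 + j)))"
    using p unfolding n' by (intro \<phi>_cat_space M \<Delta>)
  moreover have "\<phi> (2 + j) ` coord_space (M (2 + j)) \<subseteq> cat_space (\<phi> 2 ` coord_space (M 2)) (\<phi> j ` coord_space (M j))"
    using \<phi>_cat_space[of M 2 j, OF M \<Delta>] by blast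
  moreover have "\<phi> k ` coord_space (M k) \<subseteq> coord_space (words k (M 1))" for k using words by blast
  ultimately show ?thesis by (meson cat_space_mono order_refl subsetD order_trans)
qed

lemma \<phi>_quadratic_words: "p \<in> coord_space (B_exps n) \<Longrightarrow> \<phi> n p \<in> quadratic_words n"
  by (rule cat_space_quadratic_words, rule \<phi>_triple[of B_exps])
     (assumption | rule order_refl \<Delta>_coord_space_B \<phi>_coord_space_B_exps)+

section \<open>Neighbouring exponents of a leading monomial\<close>

definition subst2 :: "nat \<Rightarrow> (nat \<Rightarrow>\<^sub>0 int) \<Rightarrow> (nat \<Rightarrow>\<^sub>0 int) \<Rightarrow> (nat \<Rightarrow>\<^sub>0 int)" where
  "subst2 i m x = m + Poly_Mapping.single i (Poly_Mapping.lookup x 1 - Poly_Mapping.lookup m i)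
     + Poly_Mapping.single (Suc i) (Poly_Mapping.lookup x 2 - Poly_Mapping.lookup m (Suc i))"

lemma lookup_subst2: "Poly_Mapping.lookup (subst2 i m x) k =
    (if k = i then Poly_Mapping.lookup x 1 else if k = Suc i then Poly_Mapping.lookup x 2
     else Poly_Mapping.lookup m k)"
  by (simp add: subst2_def lookup_add lookup_single when_def)

text \<open>Entries 1 and 2 move to \<open>i\<close> and \<open>Suc i\<close>, which keeps their
  order of significance, and all other entries coincide.\<close>

lemma subst2_less:
  assumes "x \<in> supp 2" "y \<in> supp 2" "x < y"
  shows "subst2 i m x < subst2 i m y"
proof -
  obtain k where k: "Poly_Mapping.lookup x k < Poly_Mapping.lookup y k"
    "\<And>l. l < k \<Longrightarrow> Poly_Mapping.lookup x l = Poly_Mapping.lookup y l"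
    using assms(3) by (auto simp: less_poly_mapping.rep_eq less_fun_def)
  then have "k = 1 \<or> k = 2"
    using assms supp_outside[of x 2 k] supp_outside[of y 2 k] by (cases "k = 0 \<or> k > 2") (auto simp: supp_def)
  then show ?thesis unfolding less_poly_mapping.rep_eq
    by (intro less_funI exI[of _ "if k = 1 then i else Suc i"]) (use k in \<open>auto simp: lookup_subst2\<close>)
qed

text \<open>Variables count from 1 and letters from 0, so the variables \<open>i\<close> and
  \<open>Suc i\<close> are the letters \<open>i - 1\<close> and \<open>i\<close>.\<close>

lemma word_subst2:
  assumes "1 \<le> i" "i < n"
  shows "word n (subst2 i m x) = take (i - 1) (word n m) @ word 2 x @ drop (Suc i) (word n m)"
proof (rule nth_equalityI)
  fix k assume "k < length (word n (subst2 i m x))"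
  then show "word n (subst2 i m x) ! k = (take (i - 1) (word n m) @ word 2 x @ drop (Suc i) (word n m)) ! k"
    using assms
    by (cases "k < i - 1"; cases "k = i - 1"; cases "k = i")
       (auto simp: nth_append lookup_subst2 numeral_2_eq_2)
qed (use assms in auto)

text \<open>Slicing along the word of \<open>m\<close> yields some \<open>\<phi> 2 b\<close>. Its
  leading exponent is the pair \<open>h\<close> of entries of \<open>m\<close> at \<open>i\<close>
  and \<open>Suc i\<close>: a larger one would be carried by \<open>subst2\<close> to an exponent of
  \<open>F\<close> above \<open>m\<close>. Being leading for an element of \<open>B 2\<close>, it
  equals \<open>\<Lambda> 2 c\<close> for a monomial \<open>c\<close> of \<open>b\<close>.\<close>

lemma lead_quadratic_words:
  assumes F: "F \<in> coord_space (supp n)" "push (word n) F \<in> quadratic_words n" "lead F m" and i: "1 \<le> i" "i < n"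
  shows "Poly_Mapping.lookup m i \<ge> 2 * Poly_Mapping.lookup m (Suc i)"
proof -
  let ?u = "take (i - 1) (word n m)" and ?v = "drop (Suc i) (word n m)"
  have m: "m \<in> supp n" using F(1,3) by (auto simp: lead_def coord_space_def)
  have "length ?u + length ?v + 2 = n" using i by simp
  then obtain b where b: "b \<in> coord_space (B_exps 2)" "slice ?u ?v (push (word n) F) = \<phi> 2 b"
    using F(2) unfolding quadratic_words_def by blast
  have eq: "Poly_Mapping.lookup (\<Phi> 2 b) x = Poly_Mapping.lookup F (subst2 i m x)" if x: "x \<in> supp 2" for x
  proof -
    have "Poly_Mapping.keys (subst2 i m x) \<subseteq> {1..n}"
      using m i by (auto simp: supp_def in_keys_iff lookup_subst2 subset_iff split: if_splits)
    then have s: "subst2 i m x \<in> supp n" by (simp add: supp_def)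
    have "Poly_Mapping.lookup (\<Phi> 2 b) x = Poly_Mapping.lookup (\<phi> 2 b) (word 2 x)"
      using \<Phi>_coord_space_supp[OF b(1)] lookup_push_inj[OF inj_on_word _ x, of "\<Phi> 2 b"] by (simp add: \<phi>_def coord_space_def)
    also have "\<dots> = Poly_Mapping.lookup (push (word n) F) (word n (subst2 i m x))"
      by (simp add: lookup_slice word_subst2[OF i] flip: b(2))
    also have "\<dots> = Poly_Mapping.lookup F (subst2 i m x)"
      using F(1) lookup_push_inj[OF inj_on_word _ s] by (simp add: coord_space_def)
    finally show ?thesis .
  qed
  define h where "h = unword [Poly_Mapping.single 1 (Poly_Mapping.lookup m i), Poly_Mapping.single 1 (Poly_Mapping.lookup m (Suc i))]"
  have h: "h \<in> supp 2" unfolding h_def by (rule unword_supp) simp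
  have lh: "Poly_Mapping.lookup h 1 = Poly_Mapping.lookup m i" "Poly_Mapping.lookup h 2 = Poly_Mapping.lookup m (Suc i)"
    by (simp_all add: h_def lookup_unword)
  have "subst2 i m h = m" by (rule poly_mapping_eqI) (simp add: lookup_subst2 lh[unfolded One_nat_def])
  then have hG: "h \<in> Poly_Mapping.keys (\<Phi> 2 b)" using eq[OF h] F(3) by (simp add: lead_def in_keys_iff)
  then have "b \<noteq> 0" by (auto simp: lin_0[OF lin_\<Phi>])
  then obtain c where c: "c \<in> Poly_Mapping.keys b" "lead (\<Phi> 2 b) (\<Lambda> 2 c)" using lead_\<Phi>[OF b(1)] by auto
  let ?g = "\<Lambda> 2 c"
  have g: "?g \<in> supp 2" "?g \<in> Poly_Mapping.keys (\<Phi> 2 b)"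
    using c(2) \<Phi>_coord_space_supp[OF b(1)] by (auto simp: lead_def coord_space_def)
  then have "subst2 i m ?g \<in> Poly_Mapping.keys F" using eq[OF g(1)] by (simp add: in_keys_iff)
  then have "subst2 i m ?g \<le> subst2 i m h" using F(3) \<open>subst2 i m h = m\<close> by (simp add: lead_def)
  then have "\<not> h < ?g" using subst2_less[OF h g(1), of i m] by auto
  moreover have "h \<le> ?g" using c(2) hG by (simp add: lead_def)
  ultimately have hg: "h = ?g" by simp
  have "c \<in> B_exps 2" using b(1) c(1) by (auto simp: coord_space_def)
  \<comment> \<open>Only the second variable is inverted in \<open>B 2\<close>; this sign is the
    whole content of the inequality.\<close>
  then have "Poly_Mapping.lookup c 1 \<ge> 0" by (simp add: B_exps_def)
  with lookup_\<Lambda>_step[of 1 2 c] lh hg show ?thesis by (simp add: numeral_2_eq_2)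
qed

text \<open>The recursion for \<open>\<Lambda>\<close> dictates the entries of \<open>a\<close>, and
  the inequalities make those below \<open>n\<close> nonnegative. The entry of \<open>m\<close>
  after position \<open>n\<close> is 0, so the last entry of \<open>a\<close> is that of
  \<open>m\<close>; the descent uses this to keep its lower bound.\<close>

lemma \<Lambda>_surj:
  assumes m: "m \<in> supp n" and step: "\<And>i. 1 \<le> i \<Longrightarrow> i < n \<Longrightarrow> Poly_Mapping.lookup m i \<ge> 2 * Poly_Mapping.lookup m (Suc i)"
  obtains a where "a \<in> B_exps n" "\<Lambda> n a = m" "Poly_Mapping.lookup a n = Poly_Mapping.lookup m n"
proof -
  define a where "a = (\<Sum>k\<in>{1..n}. Poly_Mapping.single k (Poly_Mapping.lookup m k - 2 * Poly_Mapping.lookup m (Suc k)))"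
  have out: "Poly_Mapping.lookup m k = 0" if "k = 0 \<or> k > n" for k
    using m that supp_outside[of m n k] by (auto simp: supp_def)
  have la: "Poly_Mapping.lookup a k = (if k \<in> {1..n} then Poly_Mapping.lookup m k - 2 * Poly_Mapping.lookup m (Suc k) else 0)" for k
  proof -
    have "Poly_Mapping.lookup a k = (\<Sum>l\<in>{1..n}. if l = k then Poly_Mapping.lookup m k - 2 * Poly_Mapping.lookup m (Suc k) else 0)"
      unfolding a_def lookup_sum by (intro sum.cong refl) (auto simp: lookup_single when_def)
    then show ?thesis by auto
  qed
  have "a \<in> B_exps n" using step by (auto simp: B_exps_def la in_keys_iff split: if_splits)
  moreover have "\<Lambda> n a = m"
  proof (rule poly_mapping_eqI)
    fix i
    show "Poly_Mapping.lookup (\<Lambda> n a) i = Poly_Mapping.lookup m i"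
    \<comment> \<open>Downward induction on \<open>i\<close> from beyond \<open>n\<close>, where
      both sides vanish, since the recursion expresses entry \<open>i\<close> through entry
      \<open>Suc i\<close>.\<close>
    proof (induction "Suc n - i" arbitrary: i)
      case 0
      then show ?case by (simp add: lookup_\<Lambda>_outside out)
    next
      case (Suc d)
      show ?case
      proof (cases "i = 0")
        case True
        then show ?thesis by (simp add: lookup_\<Lambda>_outside out)
      next
        case False
        then have i: "i \<in> {1..n}" using Suc.hyps(2) by auto
        then show ?thesis using lookup_\<Lambda>_step[OF i, of a] Suc.hyps(1)[of "Suc i"] Suc.hyps(2) by (simp add: la)
      qed
    qed
  qed
  moreover have "Poly_Mapping.lookup a n = Poly_Mapping.lookup m n"
    by (cases "n = 0") (auto simp: la out)
  ultimately show ?thesis using that by blast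
qed

text \<open>The lexicographic order is not well-founded on all exponents of Laurent monomials; it is on
  those bounded below. The bounds \<open>- N * 2 ^ (n - k)\<close> are the exponents of \<open>\<Phi> n (\<alpha> n)\<^bsup>-N\<^esup>\<close>.\<close>

definition bounded_exps :: "nat \<Rightarrow> nat \<Rightarrow> (nat \<Rightarrow>\<^sub>0 int) set" where
  "bounded_exps n N = {m \<in> supp n. \<forall>k\<in>{1..n}. Poly_Mapping.lookup m k \<ge> - int N * 2 ^ (n - k)}"

text \<open>Exponents of \<open>Bplus n\<close> shifted by the exponent of the \<open>N\<close>-th
  power of the inverse of \<open>\<alpha> n\<close>.\<close>

definition bounded_B_exps :: "nat \<Rightarrow> nat \<Rightarrow> (nat \<Rightarrow>\<^sub>0 int) set" where
  "bounded_B_exps n N = {m \<in> B_exps n. Poly_Mapping.lookup m n \<ge> - int N}"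

lemma wf_bounded_exps: "wf {(a, b). a \<in> bounded_exps n N \<and> b \<in> bounded_exps n N \<and> a < b}"
proof -
  \<comment> \<open>Subtracting the lower bounds turns exponents into lists of naturals of fixed
    length \<open>n\<close>, on which the lexicographic order is well-founded.\<close>
  define g where "g m = map (\<lambda>k. nat (Poly_Mapping.lookup m (Suc k) + int N * 2 ^ (n - Suc k))) [0..<n]" for m
  have "(g a, g b) \<in> lexn less_than n"
    if a: "a \<in> bounded_exps n N" and b: "b \<in> bounded_exps n N" and ab: "a < b" for a b
  proof -
    obtain k where k: "Poly_Mapping.lookup a k < Poly_Mapping.lookup b k"
      "\<And>l. l < k \<Longrightarrow> Poly_Mapping.lookup a l = Poly_Mapping.lookup b l"
      using ab by (auto simp: less_poly_mapping.rep_eq less_fun_def)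
    then have "k \<in> {1..n}"
      using a b supp_outside[of a n k] supp_outside[of b n k]
      by (cases "k = 0 \<or> k > n") (auto simp: supp_def bounded_exps_def)
    then obtain l where l: "k = Suc l" "l < n" by (cases k) auto
    have "Poly_Mapping.lookup a k \<ge> - int N * 2 ^ (n - k)"
      using a \<open>k \<in> {1..n}\<close> unfolding bounded_exps_def by blast
    with k(1) have "g a ! l < g b ! l" using l by (simp add: g_def)
    moreover have "take l (g a) = take l (g b)"
      by (rule nth_equalityI) (use l k(2) in \<open>auto simp: g_def\<close>)
    moreover have len: "length (g a) = n" "length (g b) = n" by (simp_all add: g_def)
    ultimately have ga: "g a = take l (g a) @ g a ! l # drop (Suc l) (g a)"
      and gb: "g b = take l (g a) @ g b ! l # drop (Suc l) (g b)"
      using l(2) by (metis id_take_nth_drop)+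
    have "\<exists>xys x y xs' ys'. g a = xys @ x # xs' \<and> g b = xys @ y # ys' \<and> (x, y) \<in> less_than"
      by (intro exI conjI, rule ga, rule gb) (simp add: \<open>g a ! l < g b ! l\<close>)
    then show ?thesis by (simp add: lexn_conv len)
  qed
  then show ?thesis
    by (intro wf_subset[OF wf_inv_image[OF wf_lexn[OF wf_less_than]], of _ n g]) (auto simp: inv_image_def)
qed

lemma single_power: "Poly_Mapping.single m (1::bit) ^ N = Poly_Mapping.single (psc (int N) m) 1"
  for m :: "nat \<Rightarrow>\<^sub>0 int"
proof (induction N)
  case 0
  have "psc 0 m = 0" by (rule poly_mapping_eqI) simp
  then show ?case by simp
next
  case (Suc N)
  have "psc (int (Suc N)) m = m + psc (int N) m"
    by (rule poly_mapping_eqI) (simp add: lookup_add algebra_simps)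
  then show ?case by (simp add: Suc mult_single)
qed

lemma Bplus_exps_subset_bounded_exps: "Bplus_exps n \<subseteq> bounded_exps n N"
proof
  fix m assume m: "m \<in> Bplus_exps n"
  have "- int N * 2 ^ (n - k) \<le> Poly_Mapping.lookup m k" for k
  proof (rule order_trans)
    show "- int N * 2 ^ (n - k) \<le> 0" by simp
    show "0 \<le> Poly_Mapping.lookup m k" using m by (simp add: Bplus_exps_def)
  qed
  then show "m \<in> bounded_exps n N" using m Bplus_exps_subset_supp by (auto simp: bounded_exps_def)
qed

lemma bounded_B_exps_0: "bounded_B_exps n 0 = Bplus_exps n"
proof -
  have "Poly_Mapping.lookup m k \<ge> 0" if "m \<in> B_exps n" "Poly_Mapping.lookup m n \<ge> 0" for m k
    using that supp_outside[of m n k] by (cases k n rule: linorder_cases) (auto simp: B_exps_def)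
  then show ?thesis by (auto simp: bounded_B_exps_def Bplus_exps_def B_exps_def)
qed

text \<open>Split off the \<open>N\<close>-th power of the inverse of \<open>\<alpha> n\<close>: its
  image is the monomial whose exponents equal the lower bounds, and the remaining factor has
  nonnegative exponents only.\<close>

lemma \<Phi>_bounded:
  assumes p: "p \<in> coord_space (bounded_B_exps n N)"
  shows "\<Phi> n p \<in> coord_space (bounded_exps n N)"
proof (rule lin_coord_space[OF lin_\<Phi> coord_space_subspace _ p])
  fix m assume m: "m \<in> bounded_B_exps n N"
  show "\<Phi> n (Poly_Mapping.single m 1) \<in> coord_space (bounded_exps n N)"
  proof (cases "n = 0")
    case True
    then have "m \<in> Bplus_exps n" using m by (auto simp: bounded_B_exps_def B_exps_def Bplus_exps_def)
    then show ?thesis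
      using \<Phi>_coord_space_Bplus_exps[of "Poly_Mapping.single m 1" n] coord_space_mono[OF Bplus_exps_subset_bounded_exps[of n N]] by auto
  next
    case False
    let ?x = "Poly_Mapping.single n (- int N)" and ?m' = "m + Poly_Mapping.single n (int N)"
    have x: "?x \<in> B_exps n" using False single_B_exps_top[of n] by auto
    have "?m' \<in> bounded_B_exps n 0"
      using m False single_B_exps_top[of n "int N"] add_closed_B_exps[of n]
      by (auto simp: bounded_B_exps_def add_closed_def lookup_add)
    then have m': "?m' \<in> Bplus_exps n" by (simp add: bounded_B_exps_0)
    have "\<Phi> n (Poly_Mapping.single ?x 1) =
        (\<Prod>k\<in>{1..n}. if k = n then ipow (iter_\<alpha> n n) (- int N) else 1)"
      unfolding \<Phi>_def ev_single by (intro prod.cong refl) (auto simp: lookup_single when_def ipow_def)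
    also have "\<dots> = ipow (iter_\<alpha> n n) (- int N)" using False by simp
    also have "\<dots> = Poly_Mapping.single (- cvec n) 1 ^ N"
      by (cases "N = 0") (auto simp: ipow_inverse[OF iter_\<alpha>_top_inverse])
    also have "\<dots> = Poly_Mapping.single (psc (int N) (- cvec n)) 1" by (rule single_power)
    finally have \<Phi>x: "\<Phi> n (Poly_Mapping.single ?x 1) = Poly_Mapping.single (psc (int N) (- cvec n)) 1" .
    have m_eq: "?x + ?m' = m"
      by (rule poly_mapping_eqI) (simp add: lookup_add lookup_single when_def)
    have "Poly_Mapping.single m 1 = Poly_Mapping.single ?x 1 * (Poly_Mapping.single ?m' 1 :: laurent)"
      by (simp only: mult_single m_eq mult_1_left)
    then have "\<Phi> n (Poly_Mapping.single m 1) =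
        Poly_Mapping.single (psc (int N) (- cvec n)) 1 * \<Phi> n (Poly_Mapping.single ?m' 1)"
      using mult_onD[OF mult_on_\<Phi>[of n], of "Poly_Mapping.single ?x 1" "Poly_Mapping.single ?m' 1"]
        x m' Bplus_exps_subset_B_exps[of n] by (auto simp: \<Phi>x)
    moreover have "\<Phi> n (Poly_Mapping.single ?m' 1) \<in> coord_space (Bplus_exps n)" using m' by (intro \<Phi>_coord_space_Bplus_exps) simp
    moreover have "psc (int N) (- cvec n) + y \<in> bounded_exps n N" if "y \<in> Bplus_exps n" for y
    proof -
      have "psc (int N) (- cvec n) \<in> supp n"
        using cvec_supp(1)[of n] by (auto simp: supp_def in_keys_iff subset_iff)
      then have "psc (int N) (- cvec n) + y \<in> supp n"
        using that Bplus_exps_subset_supp add_closed_supp[of n] by (auto simp: add_closed_def)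
      then show ?thesis using that by (auto simp: bounded_exps_def lookup_add lookup_cvec Bplus_exps_def)
    qed
    ultimately show ?thesis
      using keys_mult[of "Poly_Mapping.single (psc (int N) (- cvec n)) 1" "\<Phi> n (Poly_Mapping.single ?m' 1)"]
      by (force simp: coord_space_def)
  qed
qed

text \<open>The same \<open>N\<close> bounds the tensor, every subtracted image and the preimage.
  This keeps the induction inside one well-founded set and returns a preimage in
  \<open>Bplus n\<close> when \<open>N = 0\<close>.\<close>

lemma descent:
  assumes F: "F \<in> coord_space (bounded_exps n N)" "push (word n) F \<in> quadratic_words n"
  shows "\<exists>p\<in>coord_space (bounded_B_exps n N). F = \<Phi> n p"
proof -
  have sub: "bounded_exps n N \<subseteq> supp n" by (auto simp: bounded_exps_def)
  have zero: "0 \<in> coord_space (bounded_B_exps n N)" by (rule pm.subspace_0[OF coord_space_subspace])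
  have "\<exists>p\<in>coord_space (bounded_B_exps n N). F = \<Phi> n p"
    if "F \<in> coord_space (bounded_exps n N)" "push (word n) F \<in> quadratic_words n" "lead F m" for F m
    using that
  proof (induction m arbitrary: F rule: wf_induct_rule[OF wf_bounded_exps[of n N]])
    case (1 m)
    note F = "1.prems"
    have F': "F \<in> coord_space (supp n)" using F(1) coord_space_mono[OF sub] by auto
    have m: "m \<in> bounded_exps n N" using F(1,3) by (auto simp: lead_def coord_space_def)
    obtain a where a: "a \<in> B_exps n" "\<Lambda> n a = m" "Poly_Mapping.lookup a n = Poly_Mapping.lookup m n"
      using \<Lambda>_surj[of m n] lead_quadratic_words[OF F' F(2,3)] m sub by blast
    let ?a = "Poly_Mapping.single a 1 :: laurent"
    have "Poly_Mapping.lookup m n \<ge> - int N"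
    proof (cases "n = 0")
      case True
      then show ?thesis using m supp_outside[of m n n] by (auto simp: bounded_exps_def supp_def)
    next
      case False
      then have "n \<in> {1..n}" by simp
      \<comment> \<open>At position \<open>n\<close> the weight is 1, so the bound on
        \<open>m\<close> is exactly the bound required of the last exponent of
        \<open>a\<close>.\<close>
      then have "Poly_Mapping.lookup m n \<ge> - int N * 2 ^ (n - n)"
        using m unfolding bounded_exps_def by blast
      then show ?thesis by simp
    qed
    then have a': "?a \<in> coord_space (bounded_B_exps n N)" using a by (simp add: bounded_B_exps_def)
    define G where "G = F - \<Phi> n ?a"
    have G: "G \<in> coord_space (bounded_exps n N)"
      unfolding G_def by (intro pm.subspace_diff coord_space_subspace F(1) \<Phi>_bounded a')
    have Gq: "push (word n) G \<in> quadratic_words n"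
      using quadratic_words_diff[OF F(2) \<phi>_quadratic_words[of ?a n]] a(1)
      by (simp add: G_def \<phi>_def lin_diff[OF lin_push])
    \<comment> \<open>Both leading coefficients are 1, so the two leading terms cancel.\<close>
    have Gm: "G \<in> coord_space {..<m}"
    proof -
      obtain q q' where "q \<in> coord_space {..<m}" "F = Poly_Mapping.single m 1 + q"
        "q' \<in> coord_space {..<m}" "\<Phi> n ?a = Poly_Mapping.single m 1 + q'"
        using F(3) lead_\<Phi>_monomial[OF a(1)] a(2) by (auto simp: lead_iff)
      then show ?thesis by (simp add: G_def pm.subspace_diff[OF coord_space_subspace])
    qed
    have "\<exists>p\<in>coord_space (bounded_B_exps n N). G = \<Phi> n p"
    proof (cases "G = 0")
      case True
      then show ?thesis using zero by (auto simp: lin_0[OF lin_\<Phi>] intro!: bexI[of _ 0])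
    next
      case False
      then obtain m' where m': "lead G m'" using lead_exists by blast
      then have "m' < m" "m' \<in> bounded_exps n N" using G Gm by (auto simp: lead_def coord_space_def)
      then show ?thesis using "1.IH"[of m' G] m G Gq m' by auto
    qed
    then obtain p where "p \<in> coord_space (bounded_B_exps n N)" "G = \<Phi> n p" by auto
    then show ?case using a'
      by (intro bexI[of _ "p + ?a"] pm.subspace_add[OF coord_space_subspace])
         (auto simp: lin_add[OF lin_\<Phi>] G_def algebra_simps)
  qed
  moreover have "0 = \<Phi> n 0" by (simp add: lin_0[OF lin_\<Phi>])
  ultimately show ?thesis using F lead_exists[of F] zero by metis
qed

text \<open>The sum of all absolute values of entries is a crude but sufficient \<open>N\<close>, as
  the weights \<open>2 ^ (n - k)\<close> are at least 1.\<close>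

lemma finite_bounded_exps:
  assumes "finite S" "S \<subseteq> supp n"
  shows "\<exists>N. S \<subseteq> bounded_exps n N"
proof -
  let ?N = "\<Sum>m\<in>S. \<Sum>k\<in>{1..n}. nat \<bar>Poly_Mapping.lookup m k\<bar>"
  have "m \<in> bounded_exps n ?N" if m: "m \<in> S" for m
  proof -
    have "Poly_Mapping.lookup m k \<ge> - int ?N * 2 ^ (n - k)" if k: "k \<in> {1..n}" for k
    proof -
      have "nat \<bar>Poly_Mapping.lookup m k\<bar> \<le> (\<Sum>k\<in>{1..n}. nat \<bar>Poly_Mapping.lookup m k\<bar>)"
        by (rule member_le_sum[OF k]) auto
      also have "\<dots> \<le> ?N"
        by (rule member_le_sum[OF m, of "\<lambda>m. \<Sum>k\<in>{1..n}. nat \<bar>Poly_Mapping.lookup m k\<bar>"]) (use assms(1) in auto)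
      finally have "- int ?N \<le> Poly_Mapping.lookup m k" by linarith
      moreover have "int ?N * 1 \<le> int ?N * 2 ^ (n - k)"
        by (intro mult_left_mono one_le_power of_nat_0_le_iff) simp
      ultimately show ?thesis by linarith
    qed
    then show ?thesis using m assms(2) by (auto simp: bounded_exps_def)
  qed
  then show ?thesis by blast
qed


section \<open>Quadraticity\<close>

lemma \<phi>_counit:
  assumes "p \<in> coord_space (B_exps 0)"
  shows "Poly_Mapping.lookup (\<phi> 0 p) [] = Poly_Mapping.lookup p 0"
proof -
  have "B_exps 0 \<subseteq> {0}" by (auto simp: B_exps_def)
  then have "Poly_Mapping.keys p \<subseteq> {0}" using assms by (auto simp: coord_space_def)
  then have "Poly_Mapping.lookup p m = 0" if "m \<noteq> 0" for m
    using that in_keys_iff[of m p] by auto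
  then have "p = psc (Poly_Mapping.lookup p 0) 1"
    by (intro poly_mapping_eqI) (simp add: lookup_one when_def)
  moreover have "\<phi> 0 1 = Poly_Mapping.single [] 1"
    using push_single[of "word 0" 0 "1 :: bit"] by (simp add: \<phi>_def \<Phi>_1 word_def)
  ultimately have "\<phi> 0 p = psc (Poly_Mapping.lookup p 0) (Poly_Mapping.single [] 1)"
    using lin_psc[OF lin_\<phi>, of 0 "Poly_Mapping.lookup p 0" 1] by simp
  then show ?thesis by simp
qed

text \<open>\<open>V\<close> is the piece of degree 1 and \<open>R\<close> the image of the piece of
  degree 2. Injectivity and compatibility with the coproduct are restricted from \<open>B n\<close>;
  surjectivity is asked only for tensors satisfying \<open>quadratic_words\<close>.\<close>

lemma quadratic_sub_coalg:
  assumes M: "\<And>n. M n \<subseteq> B_exps n" "0 \<in> M 0"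
    and \<Delta>: "\<And>i j p. p \<in> coord_space (M (i + j)) \<Longrightarrow> \<Delta> i j p \<in> coord_space (M i \<times> M j)"
    and words: "\<And>n p. p \<in> coord_space (M n) \<Longrightarrow> \<phi> n p \<in> coord_space (words n (M 1))"
    and surj: "\<And>n f. f \<in> coord_space (words n (M 1)) \<Longrightarrow> f \<in> quadratic_words n \<Longrightarrow> f \<in> \<phi> n ` coord_space (M n)"
  shows "quadratic (sub_coalg M)"
proof -
  let ?V = "coord_space (M 1) :: laurent set" and ?R = "\<phi> 2 ` coord_space (M 2)"
  have sub: "p \<in> coord_space (B_exps n)" if "p \<in> coord_space (M n)" for p n using that coord_space_mono[OF M(1)] by blast
  have image: "\<phi> n ` coord_space (M n) = quadratic_piece ?V ?R n" for n
  proof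
    show "\<phi> n ` coord_space (M n) \<subseteq> quadratic_piece ?V ?R n"
    proof (rule image_subsetI)
      fix p :: laurent assume p: "p \<in> coord_space (M n)"
      have "\<phi> n p \<in> cat_space (coord_space (words i (M 1))) (cat_space ?R (coord_space (words j (M 1))))" if "i + j + 2 = n" for i j
        by (rule \<phi>_triple[OF M(1) \<Delta> words p that])
      then show "\<phi> n p \<in> quadratic_piece ?V ?R n"
        using words[OF p] unfolding quadratic_piece_def tpow_coord_space by auto
    qed
    show "quadratic_piece ?V ?R n \<subseteq> \<phi> n ` coord_space (M n)"
    proof
      fix f assume f: "f \<in> quadratic_piece ?V ?R n"
      show "f \<in> \<phi> n ` coord_space (M n)"
      proof (cases "n < 2")
        case True
        then have "f \<in> coord_space (words n (M 1))" using f by (simp add: quadratic_piece_def tpow_coord_space)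
        \<comment> \<open>Below degree 2 no prefix and suffix have the required lengths, so the
          condition is void.\<close>
        moreover have "f \<in> quadratic_words n" using True by (auto simp: quadratic_words_def)
        ultimately show ?thesis by (rule surj)
      next
        case False
        then have f: "f \<in> cat_space (coord_space (words i (M 1))) (cat_space ?R (coord_space (words j (M 1))))" if "i + j + 2 = n" for i j
          using f that by (auto simp: quadratic_piece_def tpow_coord_space)
        have R: "?R \<subseteq> coord_space (words 2 (M 1))" using words by blast
        \<comment> \<open>A single relation, the one with empty prefix, already forces words of
          length \<open>n\<close> with letters in \<open>M 1\<close>.\<close>
        have "f \<in> cat_space (coord_space (words 0 (M 1))) (cat_space (coord_space (words 2 (M 1))) (coord_space (words (n - 2) (M 1))))"
          using False by (intro subsetD[OF cat_space_mono[OF order_refl cat_space_mono[OF R order_refl]] f]) simp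
        then have "f \<in> coord_space (words n (M 1))"
          unfolding cat_space_coord_space
          by (rule subsetD[OF coord_space_mono, rotated]) (use False in \<open>auto simp: words_def\<close>)
        moreover have "f \<in> quadratic_words n"
        proof (rule cat_space_quadratic_words)
          fix i j assume ij: "i + j + 2 = n"
          have "coord_space (words k (M 1)) \<subseteq> (coord_space (words k (B_exps 1)) :: (_ \<Rightarrow>\<^sub>0 bit) set)" for k
            using M(1)[of 1] by (intro coord_space_mono) (auto simp: words_def)
          moreover have "?R \<subseteq> \<phi> 2 ` coord_space (B_exps 2)" using sub by auto
          ultimately show "f \<in> cat_space (coord_space (words i (B_exps 1))) (cat_space (\<phi> 2 ` coord_space (B_exps 2)) (coord_space (words j (B_exps 1))))"
            by (intro subsetD[OF cat_space_mono[OF _ cat_space_mono] f[OF ij]])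
        qed
        ultimately show ?thesis by (rule surj)
      qed
    qed
  qed
  have "gcoalg_iso (sub_coalg M) (quadratic_coalgebra ?V ?R) \<phi>"
    unfolding gcoalg_iso_def sub_coalg_def quadratic_coalgebra_def tensor_coalgebra_def
  proof (simp only: gcoalg.simps, intro conjI allI ballI)
    show "lin_on psc (coord_space (M n)) (\<phi> n)" for n by (rule lin_on_mono[OF lin_\<phi> subset_UNIV])
    show "bij_betw (\<phi> n) (coord_space (M n)) (quadratic_piece ?V ?R n)" for n
      unfolding bij_betw_def by (intro conjI image inj_on_subset[OF inj_on_\<phi> coord_space_mono[OF M(1)]])
    show "Poly_Mapping.lookup (\<phi> 0 p) [] = Poly_Mapping.lookup p 0" if "p \<in> coord_space (M 0)" for p
      by (rule \<phi>_counit[OF sub[OF that]])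
    show "tensor_map (coord_space (M i)) (coord_space (M j)) (\<phi> i) (\<phi> j) (\<Delta> i j p) =
        push (\<lambda>w. (take i w, drop i w)) (\<phi> (i + j) p)" if "p \<in> coord_space (M (i + j))" for i j p
      using \<Delta>[OF that] by (simp add: tensor_map_eq_tmap lin_\<phi> coord_space_subspace tensor_coord_space \<phi>_\<Delta>[OF sub[OF that]])
  qed
  moreover have "?R \<subseteq> tpow ?V 2" using words by (auto simp: tpow_coord_space)
  ultimately show ?thesis
    unfolding quadratic_def
    by (intro conjI graded_coalgebra_sub_coalg M \<Delta> exI[of _ ?V] exI[of _ ?R] exI[of _ \<phi>]
        coord_space_subspace R_subspace)
qed

text \<open>The tensor is read back as a Laurent polynomial, to which the descent applies; keeping
  \<open>N\<close> locates the preimage.\<close>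

lemma \<phi>_surj:
  assumes f: "f \<in> coord_space (words n (B_exps 1))" "f \<in> quadratic_words n" and N: "unword ` Poly_Mapping.keys f \<subseteq> bounded_exps n N"
  shows "f \<in> \<phi> n ` coord_space (bounded_B_exps n N)"
proof -
  define F where "F = push unword f"
  have F: "push (word n) F = f"
    unfolding F_def push_push using f(1) by (intro push_ident) (auto simp: coord_space_def word_unword)
  have "F \<in> coord_space (bounded_exps n N)"
    using push_coord_space[of f "Poly_Mapping.keys f" unword] coord_space_mono[OF N] by (auto simp: F_def coord_space_def)
  from descent[OF this] f(2) obtain p where "p \<in> coord_space (bounded_B_exps n N)" "F = \<Phi> n p" by (auto simp: F)
  then show ?thesis using F by (auto simp: \<phi>_def)
qed

theorem theorem4p5p4:
  shows "quadratic B_coalg \<and> quadratic Bplus_coalg"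
proof
  show "quadratic B_coalg"
    unfolding B_coalg_eq
  proof (rule quadratic_sub_coalg)
    fix n and f :: "(nat \<Rightarrow>\<^sub>0 int) list \<Rightarrow>\<^sub>0 bit"
    assume f: "f \<in> coord_space (words n (B_exps 1))" "f \<in> quadratic_words n"
    have "unword ` Poly_Mapping.keys f \<subseteq> supp n" using f(1) by (auto simp: coord_space_def words_def intro!: unword_supp)
    \<comment> \<open>A tensor has finite support, so some \<open>N\<close>, depending on
      \<open>f\<close>, bounds its exponents.\<close>
    then obtain N where "unword ` Poly_Mapping.keys f \<subseteq> bounded_exps n N"
      using finite_bounded_exps[of "unword ` Poly_Mapping.keys f" n] by auto
    from \<phi>_surj[OF f this] show "f \<in> \<phi> n ` coord_space (B_exps n)"
      using coord_space_mono[of "bounded_B_exps n N" "B_exps n"] by (auto simp: bounded_B_exps_def)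
  qed (assumption | rule order_refl \<Delta>_coord_space_B \<phi>_coord_space_B_exps | simp add: B_exps_def)+
  show "quadratic Bplus_coalg"
    unfolding Bplus_coalg_eq
  proof (rule quadratic_sub_coalg)
    fix n and f :: "(nat \<Rightarrow>\<^sub>0 int) list \<Rightarrow>\<^sub>0 bit"
    assume f: "f \<in> coord_space (words n (Bplus_exps 1))" "f \<in> quadratic_words n"
    have "unword w \<in> Bplus_exps n" if "w \<in> Poly_Mapping.keys f" for w
    proof -
      have "w \<in> words n (Bplus_exps 1)" using that f(1) by (auto simp: coord_space_def)
      then have "length w = n" "\<And>k. k < n \<Longrightarrow> w ! k \<in> Bplus_exps 1" by (auto simp: words_def subset_iff)
      then show ?thesis using unword_supp[of w n] by (auto simp: Bplus_exps_def supp_def lookup_unword)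
    qed
    \<comment> \<open>Nonnegative exponents meet the bounds with \<open>N = 0\<close>, so the
      preimage found is a polynomial.\<close>
    then have "unword ` Poly_Mapping.keys f \<subseteq> bounded_exps n 0" using Bplus_exps_subset_bounded_exps by auto
    moreover have "words n (Bplus_exps 1) \<subseteq> words n (B_exps 1)" using Bplus_exps_subset_B_exps[of 1] by (auto simp: words_def)
    then have "f \<in> coord_space (words n (B_exps 1))" using f(1) coord_space_mono by blast
    ultimately show "f \<in> \<phi> n ` coord_space (Bplus_exps n)" using \<phi>_surj[of f n 0] f(2) by (simp add: bounded_B_exps_0)
  qed (assumption | rule Bplus_exps_subset_B_exps \<Delta>_coord_space_Bplus \<phi>_coord_space_Bplus_exps | simp add: Bplus_exps_def)+
qed

end
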